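(* There is an absolute constant $K$ (independent of $d$) such that the following holds. Let $\mathcal M$ be any legitimate model of order $n$ of the class of Boolean circuits over $\bigcup_{a\ge 2}\{\neg,\wedge_a,\vee_a\}$ with $\overline\neg=\neg$, let $f\in\mathcal F_n$, and let $d\ge1$, $s,k,m\ge1$. Suppose that $\rho_{d(2d+6)}(f,\mathcal M)\ge s$. Then $f$ is not computable by any depth-$d$ oracle circuit of size $s-K\big(kdn(2^{m/d}+1)\big)^K$ using connectives $\neg,\wedge_a,\vee_a$ ($a\ge2$) and $k$ oracle gates of arity $m$.
   Context: $\mathcal F_n$ is the set of Boolean functions $\{0,1\}^n\to\{0,1\}$, identified with their sets of ones; $\oplus$ is symmetric difference. The circuit class consists of Boolean circuits with inputs $x_1,\dots,x_n$, constants, and gates labeled by negation or by AND/OR of any arity $a\ge2$; depth is the number of edges on the longest path from the output to an input or constant; size is the number of gates. A depth-$d$ oracle circuit using these connectives and $k$ oracle gates of arity $m$ is such a circuit of depth $d$ in which additionally $k$ gates are oracle gates, each with $m$ ordered inputs and labeled by an arbitrary function $\{0,1\}^m\to\{0,1\}$ (possibly different for different gates and not necessarily symmetric); size counts all gates. A legitimate model of order $n$ is a set $\mathcal M$ with $\{0,1,x_1,\dots,x_n\}\subseteq\mathcal M\subseteq\mathcal F_n$ together with, for each connective $\circ$ of arity $a$, a commutative operation $\overline\circ:\mathcal M^a\to\mathcal M$; "$\overline\neg=\neg$" means $\mathcal M$ is closed under complement and $\overline\neg h=\neg h$. For a (non-oracle) circuit $C$, $\overline C\in\mathcal M$ is defined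 inductively: $\overline0=0,\overline1=1,\overline{x_i}=x_i$, gate $\circ(C_1,\dots,C_a)$ becomes $\overline\circ(\overline{C_1},\dots,\overline{C_a})$. Error sets: $\delta_\circ(f_1,\dots,f_a):=\circ(f_1,\dots,f_a)\oplus\overline\circ(f_1,\dots,f_a)$. The $D$-depth distance $\rho_D(f,\mathcal M)$ is the minimal $t$ such that there exist $g\in\mathcal M$ and $t$ tuples $(\circ_i,f^i_1,\dots,f^i_{a_i})$ with $f\oplus g\subseteq\bigcup_{i=1}^t\delta_{\circ_i}(f^i_1,\dots,f^i_{a_i})$, where each $f^i_j=\overline C$ for some (non-oracle) circuit $C$ of the class of depth at most $D-1$ and $g=\overline{E}$ for some circuit $E$ of the class of depth at most $D$; $\infty$ if no such $t$ exists. *)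

theory Defs
  imports Complex_Main "HOL-Library.Multiset" "HOL-Library.Extended_Nat"
begin

text \<open>A Boolean function of order \<open>n\<close> is its set of ones. The variables
  $x_1,\dots,x_n$ are indexed by \<open>0, ..., n - 1\<close>.\<close>

definition cube :: "nat \<Rightarrow> bool list set" where
  "cube n = {x. length x = n}"

definition bfuns :: "nat \<Rightarrow> bool list set set" where
  "bfuns n = Pow (cube n)"

definition bconst :: "nat \<Rightarrow> bool \<Rightarrow> bool list set" where
  "bconst n b = (if b then cube n else {})"

definition bvar :: "nat \<Rightarrow> nat \<Rightarrow> bool list set" where
  "bvar n i = {x \<in> cube n. x ! i}"


text \<open>\<open>And\<close> and \<open>Or\<close> stand for the whole families $\wedge_a$, $\vee_a$ with $a \ge 2$; the
  arity is the length of the argument list.\<close>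

datatype connective = Neg | And | Or

fun conn_arity :: "connective \<Rightarrow> nat \<Rightarrow> bool" where
  "conn_arity Neg a \<longleftrightarrow> a = 1"
| "conn_arity And a \<longleftrightarrow> 2 \<le> a"
| "conn_arity Or a \<longleftrightarrow> 2 \<le> a"

fun conn_eval :: "connective \<Rightarrow> bool list \<Rightarrow> bool" where
  "conn_eval Neg vs \<longleftrightarrow> \<not> vs ! 0"
| "conn_eval And vs \<longleftrightarrow> (\<forall>v \<in> set vs. v)"
| "conn_eval Or vs \<longleftrightarrow> (\<exists>v \<in> set vs. v)"

definition conn_fun :: "nat \<Rightarrow> connective \<Rightarrow> bool list set list \<Rightarrow> bool list set" where
  "conn_fun n c fs = {x \<in> cube n. conn_eval c (map (\<lambda>f. x \<in> f) fs)}"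


text \<open>Circuits are directed acyclic graphs: a list of gates in topological order together with
  an output wire. Gate number \<open>i\<close> may refer to the constants, the inputs, and the gates
  numbered less than \<open>i\<close>. Gate labels are a parameter.\<close>

datatype wire = Const bool | Input nat | Node nat

type_synonym 'l circuit = "('l \<times> wire list) list \<times> wire"

fun wf_wire :: "nat \<Rightarrow> nat \<Rightarrow> wire \<Rightarrow> bool" where
  "wf_wire n i (Const b) \<longleftrightarrow> True"
| "wf_wire n i (Input j) \<longleftrightarrow> j < n"
| "wf_wire n i (Node j) \<longleftrightarrow> j < i"

definition wf_circuit :: "('l \<Rightarrow> nat \<Rightarrow> bool) \<Rightarrow> nat \<Rightarrow> 'l circuit \<Rightarrow> bool" where
  "wf_circuit ar n C \<longleftrightarrow>
     (\<forall>i < length (fst C). ar (fst (fst C ! i)) (length (snd (fst C ! i))) \<and>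
        (\<forall>w \<in> set (snd (fst C ! i)). wf_wire n i w)) \<and>
     wf_wire n (length (fst C)) (snd C)"

fun wire_val :: "(bool \<Rightarrow> 'a) \<Rightarrow> (nat \<Rightarrow> 'a) \<Rightarrow> 'a list \<Rightarrow> wire \<Rightarrow> 'a" where
  "wire_val cst inp vs (Const b) = cst b"
| "wire_val cst inp vs (Input j) = inp j"
| "wire_val cst inp vs (Node j) = vs ! j"

text \<open>Bottom-up interpretation of a circuit in an arbitrary domain: \<open>cst\<close>, \<open>inp\<close> and \<open>app\<close>
  interpret the constants, the inputs and the gate labels.\<close>

definition gate_vals ::
  "(bool \<Rightarrow> 'a) \<Rightarrow> (nat \<Rightarrow> 'a) \<Rightarrow> ('l \<Rightarrow> 'a list \<Rightarrow> 'a) \<Rightarrow> ('l \<times> wire list) list \<Rightarrow> 'a list" where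
  "gate_vals cst inp app gs =
     foldl (\<lambda>vs (l, ws). vs @ [app l (map (wire_val cst inp vs) ws)]) [] gs"

definition circuit_val ::
  "(bool \<Rightarrow> 'a) \<Rightarrow> (nat \<Rightarrow> 'a) \<Rightarrow> ('l \<Rightarrow> 'a list \<Rightarrow> 'a) \<Rightarrow> 'l circuit \<Rightarrow> 'a" where
  "circuit_val cst inp app C = wire_val cst inp (gate_vals cst inp app (fst C)) (snd C)"

text \<open>Only gates reachable from the output contribute to the depth; all gates count for the
  size.\<close>

definition circuit_depth :: "'l circuit \<Rightarrow> nat" where
  "circuit_depth = circuit_val (\<lambda>_. 0) (\<lambda>_. 0) (\<lambda>_ ds. Suc (Max (set ds)))"

definition circuit_size :: "'l circuit \<Rightarrow> nat" where
  "circuit_size C = length (fst C)"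


text \<open>The label \<open>Oracle h\<close> only matters through the values of \<open>h\<close> on lists whose length is
  the arity of the gate.\<close>

datatype oracle_label = Conn connective | is_Oracle: Oracle "bool list \<Rightarrow> bool"

fun oracle_arity :: "nat \<Rightarrow> oracle_label \<Rightarrow> nat \<Rightarrow> bool" where
  "oracle_arity m (Conn c) a \<longleftrightarrow> conn_arity c a"
| "oracle_arity m (Oracle h) a \<longleftrightarrow> a = m"

fun label_eval :: "oracle_label \<Rightarrow> bool list \<Rightarrow> bool" where
  "label_eval (Conn c) vs = conn_eval c vs"
| "label_eval (Oracle h) vs = h vs"

definition oracle_circuit :: "nat \<Rightarrow> nat \<Rightarrow> nat \<Rightarrow> oracle_label circuit \<Rightarrow> bool" where
  "oracle_circuit n k m C \<longleftrightarrow>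
     wf_circuit (oracle_arity m) n C \<and>
     length (filter (\<lambda>g. is_Oracle (fst g)) (fst C)) = k"

definition computes :: "nat \<Rightarrow> oracle_label circuit \<Rightarrow> bool list set \<Rightarrow> bool" where
  "computes n C f \<longleftrightarrow> f = {x \<in> cube n. circuit_val (\<lambda>b. b) (\<lambda>i. x ! i) label_eval C}"


text \<open>In a model \<open>(M, apx)\<close> the operation $\overline{\circ}$ is \<open>apx c\<close>, restricted to lists
  over \<open>M\<close> whose length is an arity of \<open>c\<close>. Commutativity is invariance under all permutations
  of the arguments.\<close>

definition legitimate_model ::
  "nat \<Rightarrow> bool list set set \<Rightarrow> (connective \<Rightarrow> bool list set list \<Rightarrow> bool list set) \<Rightarrow> bool" where
  "legitimate_model n M apx \<longleftrightarrow>
     range (bconst n) \<union> bvar n ` {..<n} \<subseteq> M \<and> M \<subseteq> bfuns n \<and>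
     (\<forall>c fs. conn_arity c (length fs) \<and> set fs \<subseteq> M \<longrightarrow> apx c fs \<in> M) \<and>
     (\<forall>c fs gs. conn_arity c (length fs) \<and> set fs \<subseteq> M \<and> mset gs = mset fs \<longrightarrow>
        apx c gs = apx c fs)"

definition model_val ::
  "nat \<Rightarrow> (connective \<Rightarrow> bool list set list \<Rightarrow> bool list set) \<Rightarrow> connective circuit \<Rightarrow> bool list set"
  where "model_val n apx = circuit_val (bconst n) (bvar n) apx"

definition model_vals ::
  "nat \<Rightarrow> (connective \<Rightarrow> bool list set list \<Rightarrow> bool list set) \<Rightarrow> nat \<Rightarrow> bool list set set" where
  "model_vals n apx D =
     {model_val n apx C | C. wf_circuit conn_arity n C \<and> circuit_depth C \<le> D}"

definition error_set ::
  "nat \<Rightarrow> (connective \<Rightarrow> bool list set list \<Rightarrow> bool list set) \<Rightarrow>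
     connective \<Rightarrow> bool list set list \<Rightarrow> bool list set" where
  "error_set n apx c fs = sym_diff (conn_fun n c fs) (apx c fs)"

text \<open>Meaningful for \<open>D \<ge> 1\<close>. The infimum of the empty set in \<^typ>\<open>enat\<close> is \<open>\<infinity>\<close>.\<close>

definition depth_distance ::
  "nat \<Rightarrow> bool list set set \<Rightarrow> (connective \<Rightarrow> bool list set list \<Rightarrow> bool list set) \<Rightarrow>
     nat \<Rightarrow> bool list set \<Rightarrow> enat" where
  "depth_distance n M apx D f =
     Inf {enat (length ts) | ts. \<exists>g \<in> M. g \<in> model_vals n apx D \<and>
        (\<forall>(c, fs) \<in> set ts. conn_arity c (length fs) \<and> set fs \<subseteq> model_vals n apx (D - 1)) \<and>
        sym_diff f g \<subseteq> (\<Union>(c, fs) \<in> set ts. error_set n apx c fs)}"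

end

theory Submission imports Defs begin

text \<open>An oracle gate \<open>h\<close> with arguments \<open>h\<^sub>1, ..., h\<^sub>m\<close> is replaced by approximate gates at the price of
  polynomially many error tuples. Split the arguments into at most \<open>d\<close> blocks of length
  \<open>\<lceil>m / d\<rceil>\<close>, and evaluate the truth table \<open>S\<close> of a function of the arguments by a decision tree that
  queries one block per level. If \<open>S\<close> is uniformly random, then so is each of its residuals, so at a
  point \<open>x\<close> the probability of a wrong value is at most the sum over the levels of the probability
  that the root gates of a random tree with that many levels err at \<open>x\<close>. Where one of these
  probabilities is large, a few sampled trees already have an error at \<open>x\<close>, and greedy sampling
  covers all such \<open>x\<close>. At the other points almost all \<open>S\<close> are evaluated correctly, and \<open>h\<close> is the
  exclusive or of the random tables \<open>S\<close> and \<open>sym_diff S h\<close>; a disjunction of \<open>n + 1\<close> conjunctions of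
  \<open>n + 1\<close> such random representations is right at all these points simultaneously.\<close>

section \<open>Greedy sampling\<close>

text \<open>Uniform probability on a finite set, kept as a quotient of cardinalities. On the empty
  set it is 0 by division by zero, so conditioning on \<open>Q\<close> must treat that case
  separately.\<close>

definition proportion :: "'a set \<Rightarrow> ('a \<Rightarrow> bool) \<Rightarrow> real" where
  "proportion A P = real (card {a \<in> A. P a}) / real (card A)"

lemma proportion_nonneg: "0 \<le> proportion A P"
  by (simp add: proportion_def)

lemma proportion_mono:
  assumes "finite A" "\<And>a. a \<in> A \<Longrightarrow> P a \<Longrightarrow> Q a"
  shows "proportion A P \<le> proportion A Q"
  unfolding proportion_def
  by (intro divide_right_mono) (use assms in \<open>auto intro!: card_mono\<close>)

lemma proportion_disj_le:
  assumes "finite A"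
  shows "proportion A (\<lambda>a. P a \<or> Q a) \<le> proportion A P + proportion A Q"
proof -
  have "{a \<in> A. P a \<or> Q a} = {a \<in> A. P a} \<union> {a \<in> A. Q a}" by auto
  then have "card {a \<in> A. P a \<or> Q a} \<le> card {a \<in> A. P a} + card {a \<in> A. Q a}"
    by (simp add: card_Un_le)
  then have "real (card {a \<in> A. P a \<or> Q a}) \<le> real (card {a \<in> A. P a}) + real (card {a \<in> A. Q a})"
    by linarith
  then show ?thesis
    unfolding proportion_def add_divide_distrib[symmetric] by (intro divide_right_mono) auto
qed

lemma proportion_not:
  assumes "finite A" "A \<noteq> {}"
  shows "proportion A (\<lambda>a. \<not> P a) = 1 - proportion A P"
proof -
  have "{a \<in> A. \<not> P a} = A - {a \<in> A. P a}" by auto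
  then have "card {a \<in> A. \<not> P a} = card A - card {a \<in> A. P a}"
    using assms by (simp add: card_Diff_subset)
  moreover have "card {a \<in> A. P a} \<le> card A"
    using assms by (auto intro: card_mono)
  ultimately show ?thesis
    using assms by (simp add: proportion_def of_nat_diff field_simps)
qed

lemma proportion_bij_betw:
  assumes "bij_betw \<phi> A A"
  shows "proportion A (\<lambda>a. P (\<phi> a)) = proportion A P"
proof -
  have "bij_betw \<phi> {a \<in> A. P (\<phi> a)} {a \<in> A. P a}"
    using assms by (auto simp: bij_betw_def inj_on_def)
  then show ?thesis
    by (simp add: proportion_def bij_betw_same_card)
qed

lemma proportion_lists_all:
  \<comment> \<open>The lists of length \<open>B\<close> model \<open>B\<close> independent draws
    with replacement, so probabilities multiply.\<close>
  assumes "finite A"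
  shows "proportion {L. set L \<subseteq> A \<and> length L = B} (\<lambda>L. \<forall>a \<in> set L. P a) = proportion A P ^ B"
proof -
  have "{L \<in> {L. set L \<subseteq> A \<and> length L = B}. \<forall>a \<in> set L. P a}
      = {L. set L \<subseteq> {a \<in> A. P a} \<and> length L = B}" by auto
  then show ?thesis
    using assms by (simp add: proportion_def card_lists_length_eq power_divide)
qed

text \<open>Averaging: if every uncovered point is hit by a fraction \<open>p\<close> of
  \<open>A\<close>, then a single element of \<open>A\<close> hits a fraction \<open>p\<close> of
  the uncovered points. Each greedy choice therefore shrinks the uncovered set by a factor
  \<open>1 - p\<close>.\<close>

lemma greedy_cover:
  fixes p :: real
  assumes X: "finite X" and A: "finite A" "A \<noteq> {}" and p: "p \<le> 1"
    and dense: "\<And>x. x \<in> X \<Longrightarrow> p \<le> proportion A (\<lambda>a. R x a)"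
  shows "\<exists>L. set L \<subseteq> A \<and> length L = N \<and>
           real (card {x \<in> X. \<forall>a \<in> set L. \<not> R x a}) \<le> (1 - p) ^ N * real (card X)"
proof (induction N)
  case 0
  show ?case by simp
next
  case (Suc N)
  then obtain L where L: "set L \<subseteq> A" "length L = N"
      and le: "real (card {x \<in> X. \<forall>a \<in> set L. \<not> R x a}) \<le> (1 - p) ^ N * real (card X)"
    by blast
  define U where "U = {x \<in> X. \<forall>a \<in> set L. \<not> R x a}"
  have fU: "finite U" using X by (simp add: U_def)
  have cA: "real (card A) > 0" using A by (simp add: card_gt_0_iff)
  have "(\<Sum>a\<in>A. p * real (card U)) = (\<Sum>x\<in>U. p * real (card A))"
    by simp
  also have "\<dots> \<le> (\<Sum>x\<in>U. real (card {a \<in> A. R x a}))"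
  proof (rule sum_mono)
    fix x assume "x \<in> U"
    then have "p \<le> proportion A (\<lambda>a. R x a)" using dense by (simp add: U_def)
    then show "p * real (card A) \<le> real (card {a \<in> A. R x a})"
      using cA by (simp add: proportion_def pos_le_divide_eq)
  qed
  also have "\<dots> = real (\<Sum>x\<in>U. card {a \<in> A. R x a})" by simp
  \<comment> \<open>Double counting of the hitting pairs, now grouped by \<open>a\<close> instead of
    by \<open>x\<close>.\<close>
  also have "\<dots> = real (\<Sum>a\<in>A. card {x \<in> U. R x a})"
    using sum_multicount_gen[OF fU A(1), of "\<lambda>x a. R x a" "\<lambda>a. card {x \<in> U. R x a}"] by simp
  also have "\<dots> = (\<Sum>a\<in>A. real (card {x \<in> U. R x a}))" by simp
  finally have "(\<Sum>a\<in>A. p * real (card U)) \<le> (\<Sum>a\<in>A. real (card {x \<in> U. R x a}))" .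
  \<comment> \<open>Not every \<open>a\<close> can lie strictly below the average; strictness of the
    sum comes from \<open>A\<close> being non-empty.\<close>
  then have "\<exists>a\<in>A. p * real (card U) \<le> real (card {x \<in> U. R x a})"
    using sum_strict_mono[OF A, of "\<lambda>a. real (card {x \<in> U. R x a})" "\<lambda>a. p * real (card U)"]
    by (meson not_le)
  then obtain a where a: "a \<in> A" "p * real (card U) \<le> real (card {x \<in> U. R x a})" by blast
  have "{x \<in> X. \<forall>a' \<in> set (a # L). \<not> R x a'} = U - {x \<in> U. R x a}"
    by (auto simp: U_def)
  then have "real (card {x \<in> X. \<forall>a' \<in> set (a # L). \<not> R x a'})
      = real (card U) - real (card {x \<in> U. R x a})"
    using fU by (simp add: card_Diff_subset of_nat_diff card_mono)
  also have "\<dots> \<le> (1 - p) * real (card U)"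
    using a(2) by (simp add: algebra_simps)
  also have "\<dots> \<le> (1 - p) * ((1 - p) ^ N * real (card X))"
    using le p by (intro mult_left_mono) (auto simp: U_def)
  finally show ?case
    using a(1) L by (intro exI[of _ "a # L"]) (auto simp: mult.assoc)
qed

lemma greedy_cover_all:
  fixes p :: real
  assumes "finite X" "finite A" "A \<noteq> {}" "p \<le> 1"
    and "\<And>x. x \<in> X \<Longrightarrow> p \<le> proportion A (\<lambda>a. R x a)"
    and small: "(1 - p) ^ N * real (card X) < 1"
  shows "\<exists>L. set L \<subseteq> A \<and> length L = N \<and> (\<forall>x \<in> X. \<exists>a \<in> set L. R x a)"
proof -
  obtain L where L: "set L \<subseteq> A" "length L = N"
      "real (card {x \<in> X. \<forall>a \<in> set L. \<not> R x a}) \<le> (1 - p) ^ N * real (card X)"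
    using greedy_cover[where N = N and R = R, OF assms(1-5)] by blast
  then have "card {x \<in> X. \<forall>a \<in> set L. \<not> R x a} = 0"
    using small by linarith
  then have "{x \<in> X. \<forall>a \<in> set L. \<not> R x a} = {}"
    using assms(1) by simp
  then show ?thesis using L by blast
qed

lemma proportion_bex_le_sum:
  assumes "finite A" "finite X"
  shows "proportion A (\<lambda>a. \<exists>x \<in> X. R x a) \<le> (\<Sum>x\<in>X. proportion A (R x))"
  using assms(2)
proof (induction X rule: finite_induct)
  case empty
  then show ?case by (simp add: proportion_def)
next
  case (insert x X)
  have "proportion A (\<lambda>a. \<exists>x \<in> insert x X. R x a) = proportion A (\<lambda>a. R x a \<or> (\<exists>x \<in> X. R x a))"
    by simp
  also have "\<dots> \<le> proportion A (R x) + proportion A (\<lambda>a. \<exists>x \<in> X. R x a)"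
    by (rule proportion_disj_le[OF assms(1)])
  finally show ?case using insert by simp
qed

text \<open>Conditioning on \<open>Q\<close> costs at most the probability that \<open>Q\<close>
  fails: dropping the failing part loses that much, and dividing by the smaller set
  \<open>{a \<in> A. Q a}\<close> only increases the quotient.\<close>

lemma proportion_restrict_ge:
  assumes "finite A"
  shows "proportion A P - proportion A (\<lambda>a. \<not> Q a) \<le> proportion {a \<in> A. Q a} P"
proof (cases "{a \<in> A. Q a} = {}")
  case True
  then have "proportion A P \<le> proportion A (\<lambda>a. \<not> Q a)"
    using assms by (intro proportion_mono) auto
  then show ?thesis using proportion_nonneg[of "{a \<in> A. Q a}" P] by linarith
next
  case False
  have "proportion A P \<le> proportion A (\<lambda>a. (Q a \<and> P a) \<or> \<not> Q a)"
    using assms by (intro proportion_mono) auto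
  also have "\<dots> \<le> proportion A (\<lambda>a. Q a \<and> P a) + proportion A (\<lambda>a. \<not> Q a)"
    by (rule proportion_disj_le[OF assms])
  also have "proportion A (\<lambda>a. Q a \<and> P a) \<le> proportion {a \<in> A. Q a} P"
  proof -
    have "{a \<in> {a \<in> A. Q a}. P a} = {a \<in> A. Q a \<and> P a}" by auto
    moreover have "card {a \<in> A. Q a} \<le> card A" "0 < card {a \<in> A. Q a}"
      using assms False by (auto intro: card_mono simp: card_gt_0_iff)
    ultimately show ?thesis
      unfolding proportion_def by (auto intro!: divide_left_mono mult_pos_pos)
  qed
  finally show ?thesis by linarith
qed

section \<open>Amplification by a disjunction of conjunctions of samples\<close>

text \<open>A row \<open>L\<close> stands for the conjunction of its samples and \<open>LL\<close>
  for the disjunction of its rows. Where \<open>v\<close> is false, a row needs only one reliable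
  sample, and a union bound over all points shows that most rows have one everywhere. Where
  \<open>v\<close> is true, a row needs all samples reliable, which has probability at least 3/4.
  Greedy sampling among the rows safe for the false points then serves all true points.\<close>

lemma amplify:
  assumes X: "finite X" "card X \<le> 2 ^ n" and A: "finite A" "A \<noteq> {}"
    and wrong: "\<And>x. x \<in> X \<Longrightarrow> proportion A (W x) \<le> 1 / (4 * real (n + 1))"
  shows "\<exists>LL. length LL = n + 1 \<and> (\<forall>L \<in> set LL. set L \<subseteq> A \<and> length L = n + 1) \<and>
           (\<forall>x \<in> X. \<not> v x \<longrightarrow> (\<forall>L \<in> set LL. \<exists>a \<in> set L. \<not> W x a)) \<and>
           (\<forall>x \<in> X. v x \<longrightarrow> (\<exists>L \<in> set LL. \<forall>a \<in> set L. \<not> W x a))"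
proof -
  define T where "T = {L. set L \<subseteq> A \<and> length L = n + 1}"
  define Q where "Q L \<longleftrightarrow> (\<forall>x \<in> {x \<in> X. \<not> v x}. \<exists>a \<in> set L. \<not> W x a)" for L
  have fT: "finite T" using A finite_lists_length_eq[OF A(1)] by (simp add: T_def)
  have bad: "proportion T (\<lambda>L. \<not> Q L) \<le> 1 / 4"
  proof -
    have "proportion T (\<lambda>L. \<not> Q L) = proportion T (\<lambda>L. \<exists>x \<in> {x \<in> X. \<not> v x}. \<forall>a \<in> set L. W x a)"
      by (simp add: Q_def)
    also have "\<dots> \<le> (\<Sum>x\<in>{x \<in> X. \<not> v x}. proportion T (\<lambda>L. \<forall>a \<in> set L. W x a))"
      by (rule proportion_bex_le_sum) (use fT X in auto)
    also have "\<dots> \<le> (\<Sum>x\<in>{x \<in> X. \<not> v x}. (1 / 4) ^ (n + 1))"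
    proof (rule sum_mono)
      fix x assume "x \<in> {x \<in> X. \<not> v x}"
      then have "proportion A (W x) \<le> 1 / (4 * real (n + 1))" using wrong by simp
      also have "\<dots> \<le> 1 / 4" by (simp add: field_simps)
      finally show "proportion T (\<lambda>L. \<forall>a \<in> set L. W x a) \<le> (1 / 4) ^ (n + 1)"
        unfolding T_def proportion_lists_all[OF A(1)] by (intro power_mono proportion_nonneg)
    qed
    also have "\<dots> = real (card {x \<in> X. \<not> v x}) * (1 / 4) ^ (n + 1)" by simp
    also have "\<dots> \<le> 2 ^ n * (1 / 4) ^ (n + 1)"
    proof (rule mult_right_mono)
      have "card {x \<in> X. \<not> v x} \<le> 2 ^ n"
        using X card_mono[of X "{x \<in> X. \<not> v x}"] by auto
      then show "real (card {x \<in> X. \<not> v x}) \<le> 2 ^ n"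
        by (metis of_nat_le_iff of_nat_numeral of_nat_power)
    qed simp
    also have "\<dots> = (2 * (1 / 4)) ^ n / 4" by (simp only: power_mult_distrib power_add) simp
    also have "\<dots> \<le> 1 / 4" by (simp add: power_le_one)
    finally show ?thesis .
  qed
  have good: "1 / 2 \<le> proportion {L \<in> T. Q L} (\<lambda>L. \<forall>a \<in> set L. \<not> W x a)" if "x \<in> X" for x
  proof -
    \<comment> \<open>Bernoulli's inequality: \<open>n + 1\<close> samples, each failing with
      probability at most \<open>1 / (4 * (n + 1))\<close>, are all reliable with probability at
      least 3/4. Removing the unsafe rows costs a further 1/4.\<close>
    have "3 / 4 = 1 + real (n + 1) * (- (1 / (4 * real (n + 1))))"
      by (simp add: field_simps)
    also have "\<dots> \<le> (1 + (- (1 / (4 * real (n + 1))))) ^ (n + 1)"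
      by (rule Bernoulli_inequality) (simp add: field_simps)
    also have "\<dots> \<le> (1 - proportion A (W x)) ^ (n + 1)"
      using wrong[OF that] by (intro power_mono) (auto simp: field_simps)
    also have "\<dots> = proportion T (\<lambda>L. \<forall>a \<in> set L. \<not> W x a)"
      by (simp only: T_def proportion_lists_all[OF A(1)] proportion_not[OF A])
    finally show ?thesis using bad proportion_restrict_ge[OF fT, of "\<lambda>L. \<forall>a \<in> set L. \<not> W x a" Q]
      by linarith
  qed
  \<comment> \<open>Without safe rows the proportion of unsafe ones would be 1 rather than at most
    1/4.\<close>
  have ne: "{L \<in> T. Q L} \<noteq> {}"
  proof
    assume e: "{L \<in> T. Q L} = {}"
    then have "{L \<in> T. \<not> Q L} = T" by auto
    moreover have "T \<noteq> {}"
    proof -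
      obtain a where "a \<in> A" using A by blast
      then have "replicate (n + 1) a \<in> T" by (auto simp: T_def)
      then show ?thesis by blast
    qed
    ultimately show False using bad fT by (simp add: proportion_def)
  qed
  \<comment> \<open>Halving at most \<open>2 ^ n\<close> points \<open>n + 1\<close> times leaves
    less than one point, whence the number of rows.\<close>
  have "(1 - 1 / 2) ^ (n + 1) * real (card {x \<in> X. v x}) < 1"
  proof -
    have "card {x \<in> X. v x} \<le> 2 ^ n"
      using X card_mono[of X "{x \<in> X. v x}"] by auto
    then have "real (card {x \<in> X. v x}) \<le> 2 ^ n"
      by (metis of_nat_le_iff of_nat_numeral of_nat_power)
    then have "(1 / 2) ^ (n + 1) * real (card {x \<in> X. v x}) \<le> (1 / 2) ^ (n + 1) * 2 ^ n"
      by (intro mult_left_mono) auto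
    also have "\<dots> = 1 / 2" by (simp add: power_divide)
    finally show ?thesis by simp
  qed
  then have "\<exists>LL. set LL \<subseteq> {L \<in> T. Q L} \<and> length LL = n + 1 \<and>
      (\<forall>x \<in> {x \<in> X. v x}. \<exists>L \<in> set LL. \<forall>a \<in> set L. \<not> W x a)"
    using X fT ne good by (intro greedy_cover_all[where p = "1 / 2"]) auto
  then obtain LL where LL: "set LL \<subseteq> {L \<in> T. Q L}" "length LL = n + 1"
      "\<forall>x \<in> {x \<in> X. v x}. \<exists>L \<in> set LL. \<forall>a \<in> set L. \<not> W x a" by blast
  show ?thesis
    by (intro exI[of _ LL]) (use LL in \<open>auto simp: T_def Q_def subset_iff\<close>)
qed

section \<open>Uniformly random truth tables\<close>

lemma cube_eq_lists: "cube l = {x. set x \<subseteq> UNIV \<and> length x = l}"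
  by (simp add: cube_def)

lemma finite_cube: "finite (cube l)"
  unfolding cube_eq_lists by (rule finite_lists_length_eq) simp

lemma card_cube: "card (cube l) = 2 ^ l"
  unfolding cube_eq_lists by (subst card_lists_length_eq) simp_all

lemma finite_bfuns: "finite (bfuns l)" and bfuns_nonempty: "bfuns l \<noteq> {}"
  by (auto simp: bfuns_def finite_cube)

definition residual :: "bool list \<Rightarrow> bool list set \<Rightarrow> bool list set" where
  "residual a S = {z. a @ z \<in> S}"

text \<open>A table consists of its residual under \<open>a\<close> and of arbitrary values at the
  points that do not begin with \<open>a\<close>. Hence every residual has the same number of
  extensions, and the residual of a uniform table is uniform.\<close>

lemma proportion_residual:
  "proportion (bfuns (length a + l)) (\<lambda>S. P (residual a S)) = proportion (bfuns l) P"
proof -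
  define R where "R = cube (length a + l) - (@) a ` cube l"
  have bij: "bij_betw (\<lambda>S. (residual a S, S - (@) a ` cube l))
      {S \<in> bfuns (length a + l). P (residual a S)} ({S \<in> bfuns l. P S} \<times> Pow R)" for P
  proof (rule bij_betw_byWitness[where f' = "\<lambda>(S, S'). (@) a ` S \<union> S'"])
    have [simp]: "residual a ((@) a ` S \<union> S') = S" if "S \<in> bfuns l" "S' \<subseteq> R" for S S'
      using that by (auto simp: residual_def R_def bfuns_def cube_def)
    show "\<forall>S \<in> {S \<in> bfuns (length a + l). P (residual a S)}.
        (case (residual a S, S - (@) a ` cube l) of (S, S') \<Rightarrow> (@) a ` S \<union> S') = S"
      by (auto simp: residual_def bfuns_def cube_def)
    show "\<forall>p \<in> {S \<in> bfuns l. P S} \<times> Pow R.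
        (residual a (case p of (S, S') \<Rightarrow> (@) a ` S \<union> S'),
         (case p of (S, S') \<Rightarrow> (@) a ` S \<union> S') - (@) a ` cube l) = p"
      by (auto simp: R_def bfuns_def)
    show "(\<lambda>S. (residual a S, S - (@) a ` cube l)) ` {S \<in> bfuns (length a + l). P (residual a S)}
        \<subseteq> {S \<in> bfuns l. P S} \<times> Pow R"
      by (auto simp: residual_def R_def bfuns_def cube_def)
    show "(\<lambda>(S, S'). (@) a ` S \<union> S') ` ({S \<in> bfuns l. P S} \<times> Pow R)
        \<subseteq> {S \<in> bfuns (length a + l). P (residual a S)}"
      by (auto simp: R_def bfuns_def cube_def)
  qed
  have "card (Pow R) > 0" by (auto simp: R_def card_gt_0_iff finite_cube)
  \<comment> \<open>The bijection is used for \<open>P\<close> and for the trivial predicate; the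
    common factor \<open>card (Pow R)\<close> cancels in the quotient.\<close>
  then show ?thesis
    using bij_betw_same_card[OF bij[of P]] bij_betw_same_card[OF bij[of "\<lambda>_. True"]]
    by (simp add: proportion_def card_cartesian_product)
qed

text \<open>The map is an involution. Consequently \<open>sym_diff S H\<close> is uniform whenever
  \<open>S\<close> is, although the two tables depend on each other.\<close>

lemma bij_betw_sym_diff_bfuns:
  assumes "H \<in> bfuns l"
  shows "bij_betw (\<lambda>S. sym_diff S H) (bfuns l) (bfuns l)"
  using assms
  by (intro bij_betw_byWitness[where f' = "\<lambda>S. sym_diff S H"]) (auto simp: bfuns_def)

section \<open>Circuits and model values\<close>

lemma length_gate_vals [simp]: "length (gate_vals cst inp app gs) = length gs"
  by (induction gs rule: rev_induct) (auto simp: gate_vals_def)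

lemma gate_vals_Nil [simp]: "gate_vals cst inp app [] = []"
  by (simp add: gate_vals_def)

lemma gate_vals_snoc:
  "gate_vals cst inp app (gs @ [(l, ws)]) =
     gate_vals cst inp app gs @ [app l (map (wire_val cst inp (gate_vals cst inp app gs)) ws)]"
  by (simp add: gate_vals_def)

lemma wire_val_append:
  "wf_wire n (length vs) w \<Longrightarrow> wire_val cst inp (vs @ us) w = wire_val cst inp vs w"
  by (cases w) (auto simp: nth_append)

text \<open>Separated from the output wire so that gate lists admit induction from the
  right.\<close>

definition wf_gates :: "('l \<Rightarrow> nat \<Rightarrow> bool) \<Rightarrow> nat \<Rightarrow> ('l \<times> wire list) list \<Rightarrow> bool" where
  "wf_gates ar n gs \<longleftrightarrow>
     (\<forall>i < length gs. ar (fst (gs ! i)) (length (snd (gs ! i))) \<and>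
        (\<forall>w \<in> set (snd (gs ! i)). wf_wire n i w))"

lemma wf_circuit_iff:
  "wf_circuit ar n (gs, w) \<longleftrightarrow> wf_gates ar n gs \<and> wf_wire n (length gs) w"
  by (simp add: wf_circuit_def wf_gates_def)

lemma wf_gates_Nil [simp]: "wf_gates ar n []"
  by (simp add: wf_gates_def)

lemma wf_gates_snoc:
  "wf_gates ar n (gs @ [(l, ws)]) \<longleftrightarrow>
     wf_gates ar n gs \<and> ar l (length ws) \<and> (\<forall>w \<in> set ws. wf_wire n (length gs) w)"
  by (auto simp: wf_gates_def nth_append less_Suc_eq)

text \<open>Renumbers the wires of a circuit that is placed after \<open>k\<close> other
  gates.\<close>

fun shift_wire :: "nat \<Rightarrow> wire \<Rightarrow> wire" where
  "shift_wire k (Node j) = Node (k + j)"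
| "shift_wire k w = w"

definition shift_gates :: "nat \<Rightarrow> ('l \<times> wire list) list \<Rightarrow> ('l \<times> wire list) list" where
  "shift_gates k = map (map_prod id (map (shift_wire k)))"

lemma length_shift_gates [simp]: "length (shift_gates k gs) = length gs"
  by (simp add: shift_gates_def)

lemma wf_wire_mono: "wf_wire n i w \<Longrightarrow> i \<le> j \<Longrightarrow> wf_wire n j w"
  by (cases w) auto

lemma wf_wire_shift [simp]: "wf_wire n (k + i) (shift_wire k w) \<longleftrightarrow> wf_wire n i w"
  by (cases w) auto

lemma wire_val_shift:
  "wire_val cst inp (vs @ us) (shift_wire (length vs) w) = wire_val cst inp us w"
  by (cases w) (auto simp: nth_append)

lemma gate_vals_shift:
  "gate_vals cst inp app (gs @ shift_gates (length gs) hs) =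
     gate_vals cst inp app gs @ gate_vals cst inp app hs"
proof (induction hs rule: rev_induct)
  case Nil
  then show ?case by (simp add: shift_gates_def)
next
  case (snoc g hs)
  obtain l ws where g: "g = (l, ws)" by (cases g)
  have "gs @ shift_gates (length gs) (hs @ [g]) =
      (gs @ shift_gates (length gs) hs) @ [(l, map (shift_wire (length gs)) ws)]"
    by (simp add: shift_gates_def g)
  then show ?case
    using wire_val_shift[of cst inp "gate_vals cst inp app gs" "gate_vals cst inp app hs"]
    by (simp only: gate_vals_snoc snoc.IH g) (simp add: o_def)
qed

lemma wf_gates_shift:
  "wf_gates ar n gs \<Longrightarrow> wf_gates ar n hs \<Longrightarrow> wf_gates ar n (gs @ shift_gates (length gs) hs)"
proof (induction hs rule: rev_induct)
  case Nil
  then show ?case by (simp add: shift_gates_def)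
next
  case (snoc g hs)
  obtain l ws where g: "g = (l, ws)" by (cases g)
  have "gs @ shift_gates (length gs) (hs @ [g]) =
      (gs @ shift_gates (length gs) hs) @ [(l, map (shift_wire (length gs)) ws)]"
    by (simp add: shift_gates_def g)
  then show ?case
    using snoc by (simp only: wf_gates_snoc g) simp
qed

text \<open>Depth is one more interpretation of the gates, so the facts about
  \<open>gate_vals\<close> cover depths and model values alike.\<close>

abbreviation depth_app :: "'l \<Rightarrow> nat list \<Rightarrow> nat" where
  "depth_app \<equiv> \<lambda>_ ds. Suc (Max (set ds))"

abbreviation gate_depths :: "('l \<times> wire list) list \<Rightarrow> nat list" where
  "gate_depths \<equiv> gate_vals (\<lambda>_. 0) (\<lambda>_. 0) depth_app"

abbreviation wire_depth :: "nat list \<Rightarrow> wire \<Rightarrow> nat" where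
  "wire_depth \<equiv> wire_val (\<lambda>_. 0) (\<lambda>_. 0)"

lemma circuit_depth_eq: "circuit_depth (gs, w) = wire_depth (gate_depths gs) w"
  by (simp add: circuit_depth_def circuit_val_def)

text \<open>Each function comes with a circuit of its own; laid side by side, these circuits form
  one gate list to which a further gate can be attached. Depths do not grow, since the depth of a
  wire depends only on the gates below it.\<close>

lemma model_vals_common_gates:
  assumes "set fs \<subseteq> model_vals n apx D"
  shows "\<exists>gs ws. wf_gates conn_arity n gs \<and> (\<forall>w \<in> set ws. wf_wire n (length gs) w) \<and>
           map (wire_val (bconst n) (bvar n) (gate_vals (bconst n) (bvar n) apx gs)) ws = fs \<and>
           (\<forall>w \<in> set ws. wire_depth (gate_depths gs) w \<le> D)"
  using assms
proof (induction fs)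
  case Nil
  then show ?case by (intro exI[of _ "[]"]) auto
next
  case (Cons f fs)
  then obtain gs ws where IH: "wf_gates conn_arity n gs" "\<forall>w \<in> set ws. wf_wire n (length gs) w"
      "map (wire_val (bconst n) (bvar n) (gate_vals (bconst n) (bvar n) apx gs)) ws = fs"
      "\<forall>w \<in> set ws. wire_depth (gate_depths gs) w \<le> D"
    by auto
  obtain hs v where f: "f = model_val n apx (hs, v)" "wf_circuit conn_arity n (hs, v)"
      "circuit_depth (hs, v) \<le> D"
    using Cons.prems by (auto simp: model_vals_def)
  have wf: "wf_gates conn_arity n hs" "wf_wire n (length hs) v"
    using f by (auto simp: wf_circuit_iff)
  let ?gs = "gs @ shift_gates (length gs) hs" and ?v = "shift_wire (length gs) v"
  \<comment> \<open>The value type \<open>'x\<close> is left open because the fact is used for model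
    values and for depths.\<close>
  have old: "wire_val cst inp (gate_vals cst inp app ?gs) w = wire_val cst inp (gate_vals cst inp app gs) w"
    if "w \<in> set ws" for w and cst :: "bool \<Rightarrow> 'x" and inp app
    using IH(2) that wire_val_append[of n "gate_vals cst inp app gs" w]
    by (simp add: gate_vals_shift)
  have new: "wire_val cst inp (gate_vals cst inp app ?gs) ?v = wire_val cst inp (gate_vals cst inp app hs) v"
    for cst :: "bool \<Rightarrow> 'x" and inp app
    using wire_val_shift[of cst inp "gate_vals cst inp app gs"] by (simp add: gate_vals_shift)
  show ?case
  proof (intro exI conjI)
    show "wf_gates conn_arity n ?gs" by (rule wf_gates_shift[OF IH(1) wf(1)])
    show "\<forall>w \<in> set (?v # ws). wf_wire n (length ?gs) w"
      using wf IH(2) by (auto intro: wf_wire_mono)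
    show "map (wire_val (bconst n) (bvar n) (gate_vals (bconst n) (bvar n) apx ?gs)) (?v # ws) = f # fs"
      using IH(3) f(1) by (auto simp: old new model_val_def circuit_val_def)
    show "\<forall>w \<in> set (?v # ws). wire_depth (gate_depths ?gs) w \<le> D"
      using IH(4) f(3) by (auto simp: old new circuit_depth_eq)
  qed
qed

lemma model_vals_apply:
  assumes "set fs \<subseteq> model_vals n apx D" "conn_arity c (length fs)"
  shows "apx c fs \<in> model_vals n apx (Suc D)"
proof -
  obtain gs ws where 1: "wf_gates conn_arity n gs" "\<forall>w \<in> set ws. wf_wire n (length gs) w"
      "map (wire_val (bconst n) (bvar n) (gate_vals (bconst n) (bvar n) apx gs)) ws = fs"
      "\<forall>w \<in> set ws. wire_depth (gate_depths gs) w \<le> D"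
    using model_vals_common_gates[OF assms(1)] by blast
  let ?C = "(gs @ [(c, ws)], Node (length gs))"
  have len: "length ws = length fs" using 1(3) by auto
  \<comment> \<open>Arities exclude an empty argument list, on which \<open>Max\<close> would be
    unspecified.\<close>
  then have ne: "ws \<noteq> []" using assms(2) by (cases c) auto
  have "wf_circuit conn_arity n ?C"
    using 1 assms(2) len by (simp add: wf_circuit_iff wf_gates_snoc)
  moreover have "circuit_depth ?C \<le> Suc D"
    using 1(4) ne by (auto simp: circuit_depth_eq gate_vals_snoc nth_append)
  moreover have "model_val n apx ?C = apx c fs"
    by (simp add: model_val_def circuit_val_def gate_vals_snoc nth_append 1(3))
  ultimately show ?thesis unfolding model_vals_def by blast
qed

lemma model_vals_mono: "D \<le> D' \<Longrightarrow> model_vals n apx D \<subseteq> model_vals n apx D'"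
  unfolding model_vals_def by force

lemma bconst_in_model_vals: "bconst n b \<in> model_vals n apx D"
proof -
  have "model_val n apx ([], Const b) = bconst n b" "wf_circuit conn_arity n ([], Const b)"
      "circuit_depth ([], Const b) \<le> D"
    by (simp_all add: model_val_def circuit_val_def wf_circuit_iff circuit_depth_eq)
  then show ?thesis unfolding model_vals_def by (metis (mono_tags, lifting) mem_Collect_eq)
qed

lemma bvar_in_model_vals: "i < n \<Longrightarrow> bvar n i \<in> model_vals n apx D"
proof -
  assume "i < n"
  then have "model_val n apx ([], Input i) = bvar n i" "wf_circuit conn_arity n ([], Input i)"
      "circuit_depth ([], Input i) \<le> D"
    by (simp_all add: model_val_def circuit_val_def wf_circuit_iff circuit_depth_eq)
  then show ?thesis unfolding model_vals_def by (metis (mono_tags, lifting) mem_Collect_eq)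
qed

lemma model_vals_subset_model:
  assumes "legitimate_model n M apx"
  shows "model_vals n apx D \<subseteq> M"
proof -
  have wire: "wire_val (bconst n) (bvar n) vs w \<in> M"
    if "set vs \<subseteq> M" "wf_wire n (length vs) w" for vs w
    using that assms by (cases w) (auto simp: legitimate_model_def image_subset_iff)
  have gates: "set (gate_vals (bconst n) (bvar n) apx gs) \<subseteq> M" if "wf_gates conn_arity n gs" for gs
    using that
  proof (induction gs rule: rev_induct)
    case (snoc g gs)
    obtain c ws where g: "g = (c, ws)" by (cases g)
    let ?vs = "gate_vals (bconst n) (bvar n) apx gs"
    have "set (map (wire_val (bconst n) (bvar n) ?vs) ws) \<subseteq> M"
      using snoc wire[of ?vs] by (auto simp: g wf_gates_snoc)
    moreover have "conn_arity c (length (map (wire_val (bconst n) (bvar n) ?vs) ws))"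
      using snoc by (simp add: g wf_gates_snoc)
    ultimately have "apx c (map (wire_val (bconst n) (bvar n) ?vs) ws) \<in> M"
      using assms unfolding legitimate_model_def by blast
    then show ?case using snoc by (simp add: g gate_vals_snoc wf_gates_snoc)
  qed simp
  show ?thesis
  proof
    fix f assume "f \<in> model_vals n apx D"
    then obtain gs w where "f = model_val n apx (gs, w)" "wf_circuit conn_arity n (gs, w)"
      by (auto simp: model_vals_def)
    then show "f \<in> M"
      using gates[of gs] wire[of "gate_vals (bconst n) (bvar n) apx gs" w]
      by (simp add: model_val_def circuit_val_def wf_circuit_iff)
  qed
qed

lemma depth_distance_le:
  assumes "g \<in> M" "g \<in> model_vals n apx D"
    and "\<forall>(c, fs) \<in> set ts. conn_arity c (length fs) \<and> set fs \<subseteq> model_vals n apx (D - 1)"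
    and "sym_diff f g \<subseteq> (\<Union>(c, fs) \<in> set ts. error_set n apx c fs)"
  shows "depth_distance n M apx D f \<le> enat (length ts)"
  unfolding depth_distance_def using assms by (intro Inf_lower CollectI exI[of _ ts]) blast

section \<open>Decision trees over a model\<close>

lemma length_concat_le: "(\<And>a. a \<in> set L \<Longrightarrow> length (f a) \<le> c) \<Longrightarrow> length (concat (map f L)) \<le> length L * c"
  by (induction L) (auto intro: add_mono)

text \<open>Blocks are cut off \<open>b\<close> entries at a time. Non-emptiness keeps the gates of
  a tree at arity at least 2: a root has \<open>2 ^ length bl\<close> branches, and a branch has a
  literal besides its subtree.\<close>

lemma split_into_blocks:
  "length hs \<le> d * b \<Longrightarrow> 1 \<le> b \<Longrightarrow>
     \<exists>bls. concat bls = hs \<and> length bls \<le> d \<and> (\<forall>bl \<in> set bls. bl \<noteq> [] \<and> length bl \<le> b)"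
proof (induction d arbitrary: hs)
  case 0
  then show ?case by (intro exI[of _ "[]"]) simp
next
  case (Suc d)
  show ?case
  proof (cases "hs = []")
    case True
    then show ?thesis by (intro exI[of _ "[]"]) simp
  next
    case False
    have "length (drop b hs) \<le> d * b" using Suc.prems by simp
    then obtain bls where "concat bls = drop b hs" "length bls \<le> d"
        "\<forall>bl \<in> set bls. bl \<noteq> [] \<and> length bl \<le> b"
      using Suc.IH[of "drop b hs"] Suc.prems(2) by blast
    then show ?thesis
      using False Suc.prems(2) by (intro exI[of _ "take b hs # bls"]) auto
  qed
qed

text \<open>First summand: \<open>d\<close> levels, on each \<open>q * (n + 1)\<close> sampled
  tables with \<open>q = 8 * d * (n + 1)\<close>, and \<open>2 ^ b + 1\<close> root gates per table,
  where \<open>b\<close> is \<open>m / d\<close> rounded up. The rest: \<open>n + 1\<close> rows,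
  each with one conjunction and two disjunctions for each of \<open>n + 1\<close> samples, and the
  top disjunction.\<close>

definition oracle_cost :: "nat \<Rightarrow> nat \<Rightarrow> nat \<Rightarrow> nat" where
  "oracle_cost n d m =
     d * (8 * d * (n + 1) * (n + 1) * (2 ^ ((m + d - 1) div d) + 1)) + (n + 1) * (2 * (n + 1) + 1) + 1"

text \<open>Since \<open>(1 - 1 / q) ^ q\<close> is at most 1/e and so at most 1/2,
  \<open>q * (n + 1)\<close> greedy choices with density \<open>1 / q\<close> cover all of at most
  \<open>2 ^ n\<close> points.\<close>

lemma one_minus_power_small:
  fixes q :: nat
  assumes "1 \<le> q"
  shows "(1 - 1 / real q) ^ (q * (n + 1)) * 2 ^ n < 1"
proof -
  have "(1 - 1 / real q) ^ q \<le> exp (- (1 / real q)) ^ q"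
    using assms exp_ge_add_one_self[of "- (1 / real q)"] by (intro power_mono) auto
  also have "\<dots> = exp (- 1)"
    using assms by (simp flip: exp_of_nat_mult)
  also have "\<dots> \<le> 1 / 2"
    using exp_ge_add_one_self[of 1] by (simp add: exp_minus field_simps)
  finally have "((1 - 1 / real q) ^ q) ^ (n + 1) \<le> (1 / 2) ^ (n + 1)"
    using assms by (intro power_mono) auto
  then have "(1 - 1 / real q) ^ (q * (n + 1)) * 2 ^ n \<le> (1 / 2) ^ (n + 1) * 2 ^ n"
    unfolding power_mult by (intro mult_right_mono) auto
  also have "\<dots> = 1 / 2" by (simp add: power_divide)
  finally show ?thesis by simp
qed

definition assignments :: "nat \<Rightarrow> bool list list" where
  "assignments b = List.n_lists b [False, True]"

lemma set_assignments: "set (assignments b) = {a. length a = b}"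
  by (auto simp: assignments_def set_n_lists)

lemma length_assignments: "length (assignments b) = 2 ^ b"
  by (simp add: assignments_def length_n_lists numeral_2_eq_2)

section \<open>Error tuples and trees in a fixed model\<close>

locale negation_model =
  fixes n :: nat and M :: "bool list set set"
    and apx :: "connective \<Rightarrow> bool list set list \<Rightarrow> bool list set"
  assumes legitimate: "legitimate_model n M apx"
    and negation: "\<And>h. h \<in> M \<Longrightarrow> apx Neg [h] = cube n - h"
begin

abbreviation vals :: "nat \<Rightarrow> bool list set set" where
  "vals \<equiv> model_vals n apx"

definition errors :: "(connective \<times> bool list set list) list \<Rightarrow> bool list set" where
  "errors ts = (\<Union>(c, fs) \<in> set ts. error_set n apx c fs)"

text \<open>The condition on tuples in \<open>depth_distance\<close>; here \<open>D\<close> bounds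
  the arguments, so it corresponds to distance depth \<open>D + 1\<close>.\<close>

definition admissible :: "nat \<Rightarrow> (connective \<times> bool list set list) list \<Rightarrow> bool" where
  "admissible D ts \<longleftrightarrow> (\<forall>(c, fs) \<in> set ts. conn_arity c (length fs) \<and> set fs \<subseteq> vals D)"

lemma errors_append [simp]: "errors (ts @ us) = errors ts \<union> errors us"
  by (auto simp: errors_def)

lemma errors_Nil [simp]: "errors [] = {}"
  by (simp add: errors_def)

lemma errors_Cons [simp]: "errors ((c, fs) # ts) = error_set n apx c fs \<union> errors ts"
  by (auto simp: errors_def)

lemma errors_concat: "errors (concat (map f L)) = (\<Union>a \<in> set L. errors (f a))"
  by (induction L) auto

lemma admissible_append [simp]: "admissible D (ts @ us) \<longleftrightarrow> admissible D ts \<and> admissible D us"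
  by (auto simp: admissible_def)

lemma admissible_Nil [simp]: "admissible D []"
  by (simp add: admissible_def)

lemma admissible_Cons [simp]:
  "admissible D ((c, fs) # ts) \<longleftrightarrow> conn_arity c (length fs) \<and> set fs \<subseteq> vals D \<and> admissible D ts"
  by (auto simp: admissible_def)

lemma admissible_concat: "admissible D (concat (map f L)) \<longleftrightarrow> (\<forall>a \<in> set L. admissible D (f a))"
  by (induction L) auto

lemma admissible_mono: "admissible D ts \<Longrightarrow> D \<le> D' \<Longrightarrow> admissible D' ts"
  using model_vals_mono[of D D' n apx] unfolding admissible_def by fastforce

lemma apx_sound:
  "x \<in> cube n \<Longrightarrow> x \<notin> error_set n apx c fs \<Longrightarrow>
     x \<in> apx c fs \<longleftrightarrow> conn_eval c (map (\<lambda>f. x \<in> f) fs)"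
  by (auto simp: error_set_def conn_fun_def)

text \<open>Negation is exact in the model, so a complement costs one level of depth but no error
  tuple.\<close>

lemma complement_in_vals:
  assumes "h \<in> vals D"
  shows "cube n - h \<in> vals (Suc D)"
  using model_vals_apply[of "[h]" n apx D Neg] negation[of h] assms
    model_vals_subset_model[OF legitimate] by fastforce

definition literals :: "bool list \<Rightarrow> bool list set list \<Rightarrow> bool list set list" where
  "literals a bl = map2 (\<lambda>b h. if b then h else cube n - h) a bl"

lemma literals_true_iff:
  assumes "x \<in> cube n" "length a = length bl"
  shows "(\<forall>h \<in> set (literals a bl). x \<in> h) \<longleftrightarrow> a = map (\<lambda>h. x \<in> h) bl"
  using assms(2) assms(1) by (induction a bl rule: list_induct2) (auto simp: literals_def)

lemma literals_in_vals:
  assumes "set bl \<subseteq> vals D"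
  shows "set (literals a bl) \<subseteq> vals (Suc D)"
  using assms complement_in_vals model_vals_mono[of D "Suc D" n apx]
  by (fastforce simp: literals_def dest: set_zip_rightD)

text \<open>The table \<open>S\<close> is a set of assignments to the concatenated blocks.\<close>

fun tree :: "bool list set list list \<Rightarrow> bool list set \<Rightarrow> bool list set" where
  "tree [] S = bconst n ([] \<in> S)"
| "tree (bl # bls) S = apx Or (map (\<lambda>a. apx And (literals a bl @ [tree bls (residual a S)]))
     (assignments (length bl)))"

definition branch_gate where
  "branch_gate bl bls S a = (And, literals a bl @ [tree bls (residual a S)])"

text \<open>Only the gates of the first level of a tree. Those of the subtrees are paid for at the
  later levels, where tables for the remaining blocks are sampled afresh.\<close>

definition root_gates where
  "root_gates bl bls S =
     (Or, map (\<lambda>a. apx And (literals a bl @ [tree bls (residual a S)])) (assignments (length bl))) #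
     map (branch_gate bl bls S) (assignments (length bl))"

lemma length_root_gates: "length (root_gates bl bls S) = 2 ^ length bl + 1"
  by (simp add: root_gates_def length_assignments)

lemma two_le_two_power: "bl \<noteq> [] \<Longrightarrow> (2::nat) \<le> 2 ^ length bl"
  by (cases bl) auto

lemma branch_gate_ok:
  assumes "set bl \<subseteq> vals D" "bl \<noteq> []" "length a = length bl"
    and "\<And>S. tree bls S \<in> vals (Suc D + 2 * length bls)"
  shows "set (literals a bl @ [tree bls (residual a S)]) \<subseteq> vals (Suc D + 2 * length bls)"
    and "conn_arity And (length (literals a bl @ [tree bls (residual a S)]))"
proof -
  show "set (literals a bl @ [tree bls (residual a S)]) \<subseteq> vals (Suc D + 2 * length bls)"
    using literals_in_vals[OF assms(1), of a] assms(4)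
      model_vals_mono[of "Suc D" "Suc D + 2 * length bls" n apx] by auto
  show "conn_arity And (length (literals a bl @ [tree bls (residual a S)]))"
    using assms(2,3) by (cases bl) (auto simp: literals_def)
qed

text \<open>One level for negated literals at the bottom, then a conjunction and a disjunction per
  block.\<close>

lemma tree_in_vals:
  assumes "set (concat bls) \<subseteq> vals D" "\<forall>bl \<in> set bls. bl \<noteq> []"
  shows "tree bls S \<in> vals (Suc D + 2 * length bls)"
  using assms
proof (induction bls arbitrary: S)
  case Nil
  then show ?case by (simp add: bconst_in_model_vals)
next
  case (Cons bl bls)
  let ?arg = "\<lambda>a. apx And (literals a bl @ [tree bls (residual a S)])"
  have "?arg a \<in> vals (Suc (Suc D + 2 * length bls))" if "length a = length bl" for a
    using Cons that by (intro model_vals_apply branch_gate_ok) auto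
  then have "apx Or (map ?arg (assignments (length bl))) \<in> vals (Suc (Suc (Suc D + 2 * length bls)))"
    using Cons.prems(2) two_le_two_power
    by (intro model_vals_apply) (auto simp: set_assignments length_assignments)
  then show ?case by simp
qed

lemma admissible_root_gates:
  assumes "set (concat (bl # bls)) \<subseteq> vals D" "\<forall>bl \<in> set (bl # bls). bl \<noteq> []"
  shows "admissible (D + 2 * length (bl # bls)) (root_gates bl bls S)"
proof -
  have t: "tree bls S \<in> vals (Suc D + 2 * length bls)" for S
    using assms by (intro tree_in_vals) auto
  note br = branch_gate_ok[of bl D _ bls, OF _ _ _ t]
  have 1: "admissible (Suc D + 2 * length bls) (map (branch_gate bl bls S) (assignments (length bl)))"
    using br assms by (fastforce simp: admissible_def branch_gate_def set_assignments)
  have "apx And (literals a bl @ [tree bls (residual a S)]) \<in> vals (Suc (Suc D + 2 * length bls))"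
    if "length a = length bl" for a
    using that assms by (intro model_vals_apply br) auto
  then have "admissible (Suc (Suc D + 2 * length bls)) (root_gates bl bls S)"
    using assms(2) two_le_two_power admissible_mono[OF 1, of "Suc (Suc D + 2 * length bls)"]
    by (auto simp: root_gates_def set_assignments length_assignments)
  then show ?thesis by simp
qed

definition wrong :: "bool list set list list \<Rightarrow> bool list \<Rightarrow> bool list set \<Rightarrow> bool" where
  "wrong bls x S \<longleftrightarrow> (x \<in> tree bls S) \<noteq> (map (\<lambda>h. x \<in> h) (concat bls) \<in> S)"

text \<open>Outside the errors of the root gates, exactly the branch labelled by the true values of
  \<open>bl\<close> at \<open>x\<close> can fire, and it passes on the value of its subtree. A wrong
  value must therefore already occur there.\<close>

lemma wrong_Cons:
  assumes x: "x \<in> cube n" and wrong: "wrong (bl # bls) x S"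
    and sound: "x \<notin> errors (root_gates bl bls S)"
  shows "wrong bls x (residual (map (\<lambda>h. x \<in> h) bl) S)"
proof -
  let ?a = "map (\<lambda>h. x \<in> h) bl"
  have "x \<notin> error_set n apx And (literals a bl @ [tree bls (residual a S)])"
    if "length a = length bl" for a
    using sound that by (auto simp: root_gates_def errors_def branch_gate_def set_assignments)
  then have br: "x \<in> apx And (literals a bl @ [tree bls (residual a S)]) \<longleftrightarrow>
      a = ?a \<and> x \<in> tree bls (residual a S)" if "length a = length bl" for a
    using that apx_sound[OF x] literals_true_iff[OF x that] by auto
  have "x \<in> tree (bl # bls) S \<longleftrightarrow>
      (\<exists>a. length a = length bl \<and> x \<in> apx And (literals a bl @ [tree bls (residual a S)]))"
    using sound apx_sound[OF x] by (auto simp: root_gates_def set_assignments)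
  also have "\<dots> \<longleftrightarrow> x \<in> tree bls (residual ?a S)"
    using br by (metis length_map)
  finally show ?thesis
    using wrong by (simp add: wrong_def residual_def)
qed

text \<open>At fixed \<open>x\<close> the prefix read by the root is fixed, so the residual table is
  again uniform and the second case is the same question for fewer blocks.\<close>

lemma proportion_wrong_Cons:
  assumes x: "x \<in> cube n"
  shows "proportion (bfuns (length (concat (bl # bls)))) (wrong (bl # bls) x)
      \<le> proportion (bfuns (length (concat (bl # bls)))) (\<lambda>S. x \<in> errors (root_gates bl bls S))
        + proportion (bfuns (length (concat bls))) (wrong bls x)"
proof -
  let ?A = "bfuns (length (concat (bl # bls)))" and ?a = "map (\<lambda>h. x \<in> h) bl"
  have "proportion ?A (wrong (bl # bls) x)
      \<le> proportion ?A (\<lambda>S. x \<in> errors (root_gates bl bls S) \<or> wrong bls x (residual ?a S))"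
    using wrong_Cons[OF x] by (intro proportion_mono finite_bfuns) blast
  also have "\<dots> \<le> proportion ?A (\<lambda>S. x \<in> errors (root_gates bl bls S))
      + proportion ?A (\<lambda>S. wrong bls x (residual ?a S))"
    by (intro proportion_disj_le finite_bfuns)
  also have "proportion ?A (\<lambda>S. wrong bls x (residual ?a S))
      = proportion (bfuns (length (concat bls))) (wrong bls x)"
    using proportion_residual[of ?a "length (concat bls)" "wrong bls x"] by simp
  finally show ?thesis .
qed

text \<open>On each level, the points where the root gates of a random tree err with probability at
  least \<open>p\<close> are covered by the errors of \<open>N\<close> sampled trees. At every other
  point each level adds at most \<open>p\<close> to the failure probability.\<close>

lemma tree_mostly_right:
  fixes p :: real
  assumes p: "p \<le> 1" and N: "(1 - p) ^ N * 2 ^ n < 1"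
    and "set (concat bls) \<subseteq> vals D" "\<forall>bl \<in> set bls. bl \<noteq> [] \<and> length bl \<le> b"
  shows "\<exists>ts. admissible (D + 2 * length bls) ts \<and> length ts \<le> length bls * (N * (2 ^ b + 1)) \<and>
      (\<forall>x \<in> cube n - errors ts.
         proportion (bfuns (length (concat bls))) (wrong bls x) \<le> real (length bls) * p)"
  using assms(3,4)
proof (induction bls)
  case Nil
  then show ?case
    by (intro exI[of _ "[]"]) (auto simp: proportion_def wrong_def bconst_def)
next
  case (Cons bl bls)
  then obtain ts where ts: "admissible (D + 2 * length bls) ts"
      "length ts \<le> length bls * (N * (2 ^ b + 1))"
      "\<forall>x \<in> cube n - errors ts.
         proportion (bfuns (length (concat bls))) (wrong bls x) \<le> real (length bls) * p"
    by auto
  let ?A = "bfuns (length (concat (bl # bls)))"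
  let ?R = "\<lambda>x S. x \<in> errors (root_gates bl bls S)"
  \<comment> \<open>The points where the root is too unreliable; the errors collected for this level
    must cover exactly these.\<close>
  define X where "X = {x \<in> cube n. p \<le> proportion ?A (?R x)}"
  have X: "finite X" "card X \<le> 2 ^ n"
    using finite_cube[of n] card_mono[of "cube n" X] by (auto simp: X_def card_cube)
  then have "real (card X) \<le> 2 ^ n"
    by (metis of_nat_le_iff of_nat_numeral of_nat_power)
  then have "(1 - p) ^ N * real (card X) \<le> (1 - p) ^ N * 2 ^ n"
    using p by (intro mult_left_mono) auto
  then have "\<exists>L. set L \<subseteq> ?A \<and> length L = N \<and> (\<forall>x \<in> X. \<exists>S \<in> set L. ?R x S)"
    using X N p finite_bfuns bfuns_nonempty
    by (intro greedy_cover_all[where p = p]) (auto simp: X_def)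
  then obtain L where L: "length L = N" "\<forall>x \<in> X. \<exists>S \<in> set L. ?R x S" by blast
  let ?ts = "concat (map (root_gates bl bls) L) @ ts"
  show ?case
  proof (intro exI conjI ballI)
    show "admissible (D + 2 * length (bl # bls)) ?ts"
      using Cons.prems admissible_mono[OF ts(1), of "D + 2 * length (bl # bls)"]
        admissible_root_gates[of bl bls D]
      by (simp add: admissible_concat)
    have "(2::nat) ^ length bl \<le> 2 ^ b"
      using Cons.prems(2) by (intro power_increasing) auto
    then have "length (concat (map (root_gates bl bls) L)) \<le> N * (2 ^ b + 1)"
      using length_concat_le[of L "root_gates bl bls" "2 ^ b + 1"] L(1)
      by (simp only: length_root_gates)
    then show "length ?ts \<le> length (bl # bls) * (N * (2 ^ b + 1))"
      using ts(2) by (simp only: length_append list.size) (simp add: algebra_simps)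
  next
    fix x assume x: "x \<in> cube n - errors ?ts"
    then have "x \<notin> X" using L(2) by (auto simp: errors_concat)
    then have "proportion ?A (?R x) \<le> p" using x by (simp add: X_def)
    moreover have "proportion (bfuns (length (concat bls))) (wrong bls x) \<le> real (length bls) * p"
      using ts(3) x by simp
    ultimately show "proportion ?A (wrong (bl # bls) x) \<le> real (length (bl # bls)) * p"
      using proportion_wrong_Cons[of x bl bls] x by (simp add: algebra_simps)
  qed
qed

section \<open>Replacing oracle gates\<close>

text \<open>The exclusive or of \<open>tree bls S\<close> and \<open>tree bls (sym_diff S H)\<close> is written as a conjunction of two
  disjunctions so that it merges with the conjunction over the samples; this saves one level.\<close>

definition xor_gates where
  "xor_gates bls H S =
     [(Or, [tree bls S, tree bls (sym_diff S H)]),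
      (Or, [cube n - tree bls S, cube n - tree bls (sym_diff S H)])]"

definition conj_args where
  "conj_args bls H L = concat (map (\<lambda>S. map (\<lambda>(c, fs). apx c fs) (xor_gates bls H S)) L)"

definition top_gates where
  "top_gates bls H LL =
     (Or, map (\<lambda>L. apx And (conj_args bls H L)) LL) #
     concat (map (\<lambda>L. (And, conj_args bls H L) # concat (map (xor_gates bls H) L)) LL)"

lemma length_conj_args: "length (conj_args bls H L) = 2 * length L"
  by (induction L) (auto simp: conj_args_def xor_gates_def)

lemma length_top_gates:
  assumes "\<forall>L \<in> set LL. length L = B"
  shows "length (top_gates bls H LL) \<le> length LL * (2 * B + 1) + 1"
proof -
  have "length (concat (map (xor_gates bls H) L)) \<le> length L * 2" for L
    by (rule length_concat_le) (simp add: xor_gates_def)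
  then have "length ((And, conj_args bls H L) # concat (map (xor_gates bls H) L)) \<le> 2 * B + 1"
    if "L \<in> set LL" for L
    using assms that by (auto simp: mult.commute)
  then have "length (concat (map (\<lambda>L. (And, conj_args bls H L) # concat (map (xor_gates bls H) L)) LL))
      \<le> length LL * (2 * B + 1)"
    by (rule length_concat_le)
  then show ?thesis by (simp add: top_gates_def)
qed

text \<open>Depth count above trees of depth \<open>E\<close>: complements at \<open>E + 1\<close>,
  disjunctions at \<open>E + 2\<close>, rows at \<open>E + 3\<close>, the top disjunction at
  \<open>E + 4\<close>. The assumptions on \<open>LL\<close> give the top disjunction and the rows
  arity at least 2.\<close>

lemma top_gates_ok:
  assumes tree: "\<And>S. tree bls S \<in> vals E"
    and LL: "2 \<le> length LL" "\<forall>L \<in> set LL. L \<noteq> []"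
  shows "admissible (E + 3) (top_gates bls H LL)"
    and "apx Or (map (\<lambda>L. apx And (conj_args bls H L)) LL) \<in> vals (E + 4)"
proof -
  have 1: "admissible (Suc E) (xor_gates bls H S)" for S
    using tree complement_in_vals model_vals_mono[of E "Suc E" n apx]
    by (auto simp: xor_gates_def)
  have "apx c fs \<in> vals (Suc (Suc E))" if "(c, fs) \<in> set (xor_gates bls H S)" for c fs S
    using 1[of S] that by (intro model_vals_apply) (auto simp: admissible_def)
  then have 2: "set (conj_args bls H L) \<subseteq> vals (Suc (Suc E))" for L
    by (auto simp: conj_args_def)
  have ar: "conn_arity And (length (conj_args bls H L))" if "L \<in> set LL" for L
    using LL(2) that by (cases L) (auto simp: length_conj_args)
  have 3: "set (map (\<lambda>L. apx And (conj_args bls H L)) LL) \<subseteq> vals (Suc (Suc (Suc E)))"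
    using 2 ar by (auto intro!: model_vals_apply)
  have "admissible (Suc (Suc (Suc E))) ((And, conj_args bls H L) # concat (map (xor_gates bls H) L))"
    if "L \<in> set LL" for L
    using ar[OF that] 2[of L] admissible_mono[OF 1, of "Suc (Suc (Suc E))"]
      model_vals_mono[of "Suc (Suc E)" "Suc (Suc (Suc E))" n apx]
    by (auto simp: admissible_concat)
  then have "admissible (Suc (Suc (Suc E))) (top_gates bls H LL)"
    using 3 LL(1) by (simp add: top_gates_def admissible_concat)
  then show "admissible (E + 3) (top_gates bls H LL)"
    by (simp add: numeral_3_eq_3)
  have "apx Or (map (\<lambda>L. apx And (conj_args bls H L)) LL) \<in> vals (Suc (Suc (Suc (Suc E))))"
    using 3 LL(1) by (intro model_vals_apply) auto
  then show "apx Or (map (\<lambda>L. apx And (conj_args bls H L)) LL) \<in> vals (E + 4)"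
    by (simp add: eval_nat_numeral)
qed

text \<open>The two disjunctions of a sample hold together exactly when its two tree values differ,
  so a row asks this of all its samples at once.\<close>

lemma top_value:
  assumes x: "x \<in> cube n" "x \<notin> errors (top_gates bls H LL)"
  shows "x \<in> apx Or (map (\<lambda>L. apx And (conj_args bls H L)) LL) \<longleftrightarrow>
     (\<exists>L \<in> set LL. \<forall>S \<in> set L. (x \<in> tree bls S) \<noteq> (x \<in> tree bls (sym_diff S H)))"
proof -
  have no: "x \<notin> error_set n apx And (conj_args bls H L)"
      "S \<in> set L \<Longrightarrow> x \<notin> errors (xor_gates bls H S)" if "L \<in> set LL" for L S
    using x(2) that by (auto simp: top_gates_def errors_concat)
  have xor: "(\<forall>g \<in> set (map (\<lambda>(c, fs). apx c fs) (xor_gates bls H S)). x \<in> g) \<longleftrightarrow>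
      (x \<in> tree bls S) \<noteq> (x \<in> tree bls (sym_diff S H))" if "L \<in> set LL" "S \<in> set L" for L S
    using no(2)[OF that] x(1) by (auto simp: xor_gates_def apx_sound)
  have "x \<in> apx And (conj_args bls H L) \<longleftrightarrow> (\<forall>g \<in> set (conj_args bls H L). x \<in> g)"
    if "L \<in> set LL" for L
    using apx_sound[OF x(1) no(1)[OF that]] by simp
  moreover have "(\<forall>g \<in> set (conj_args bls H L). x \<in> g) \<longleftrightarrow>
      (\<forall>S \<in> set L. \<forall>g \<in> set (map (\<lambda>(c, fs). apx c fs) (xor_gates bls H S)). x \<in> g)" for L
    unfolding conj_args_def by auto
  ultimately have "x \<in> apx And (conj_args bls H L) \<longleftrightarrow>
      (\<forall>S \<in> set L. (x \<in> tree bls S) \<noteq> (x \<in> tree bls (sym_diff S H)))" if "L \<in> set LL" for L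
    using xor[OF that] that by simp
  moreover have "x \<notin> error_set n apx Or (map (\<lambda>L. apx And (conj_args bls H L)) LL)"
    using x(2) by (simp add: top_gates_def)
  ultimately show ?thesis
    using apx_sound[OF x(1)] by auto
qed

text \<open>With \<open>H\<close> the table of \<open>h\<close>, correct values of \<open>S\<close>
  and of \<open>sym_diff S H\<close> differ exactly where \<open>h\<close> is true. Both tables are
  uniform, so \<open>tree_mostly_right\<close> bounds both failures and \<open>amplify\<close>
  selects the samples. Trees reach depth \<open>D + 2 * d + 1\<close> and their combination adds
  four levels.\<close>

lemma oracle_gate:
  assumes hs: "set hs \<subseteq> vals D" "1 \<le> length hs" and d: "1 \<le> d" and n: "1 \<le> n"
  shows "\<exists>g ts. g \<in> vals (D + (2 * d + 6)) \<and> admissible (D + (2 * d + 5)) ts \<and>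
           length ts \<le> oracle_cost n d (length hs) \<and>
           (\<forall>x \<in> cube n - errors ts. x \<in> g \<longleftrightarrow> h (map (\<lambda>f. x \<in> f) hs))"
proof -
  define m where "m = length hs"
  define b where "b = (m + d - 1) div d"
  \<comment> \<open>With error \<open>1 / q\<close> per level, the tables \<open>S\<close> and \<open>sym_diff S H\<close> together fail with probability
    at most \<open>1 / (4 * (n + 1))\<close>, as amplification requires.\<close>
  define q where "q = 8 * d * (n + 1)"
  have m: "1 \<le> m" using hs by (simp add: m_def)
  \<comment> \<open>\<open>b\<close> is \<open>m / d\<close> rounded up, so \<open>d\<close> blocks
    of length \<open>b\<close> suffice.\<close>
  have "m + d - 1 = d * b + (m + d - 1) mod d" by (simp add: b_def)
  moreover have "(m + d - 1) mod d < d" using d by simp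
  ultimately have "m \<le> d * b" by linarith
  moreover have b1: "1 \<le> b" using m d by (cases b) (use \<open>m \<le> d * b\<close> in auto)
  ultimately obtain bls where bls: "concat bls = hs" "length bls \<le> d"
      "\<forall>bl \<in> set bls. bl \<noteq> [] \<and> length bl \<le> b"
    using split_into_blocks[of hs d b] by (auto simp: m_def)
  have q1: "1 \<le> q" using d by (simp add: q_def)
  obtain ts0 where ts0: "admissible (D + 2 * length bls) ts0"
      "length ts0 \<le> length bls * (q * (n + 1) * (2 ^ b + 1))"
      "\<forall>x \<in> cube n - errors ts0. proportion (bfuns m) (wrong bls x) \<le> real (length bls) * (1 / real q)"
    using tree_mostly_right[OF _ one_minus_power_small[OF q1], where bls = bls and D = D and b = b] bls hs q1
    by (auto simp: m_def)
  define H where "H = {y \<in> cube m. h y}"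
  have H: "H \<in> bfuns m" by (auto simp: H_def bfuns_def)
  define y where "y x = map (\<lambda>f. x \<in> f) hs" for x
  \<comment> \<open>A sample counts as unreliable as soon as one of its two trees is wrong.\<close>
  define W where "W x S \<longleftrightarrow> wrong bls x S \<or> wrong bls x (sym_diff S H)" for x S
  define X where "X = cube n - errors ts0"
  have X: "finite X" "card X \<le> 2 ^ n"
    using finite_cube[of n] card_mono[of "cube n" X] by (auto simp: X_def card_cube)
  have small: "proportion (bfuns m) (W x) \<le> 1 / (4 * real (n + 1))" if "x \<in> X" for x
  proof -
    have "proportion (bfuns m) (W x)
        \<le> proportion (bfuns m) (wrong bls x) + proportion (bfuns m) (\<lambda>S. wrong bls x (sym_diff S H))"
      unfolding W_def by (intro proportion_disj_le finite_bfuns)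
    also have "\<dots> = 2 * proportion (bfuns m) (wrong bls x)"
      using proportion_bij_betw[OF bij_betw_sym_diff_bfuns[OF H], of "wrong bls x"] by simp
    also have "\<dots> \<le> 2 * (real (length bls) * (1 / real q))"
      using ts0(3) that by (intro mult_left_mono) (auto simp: X_def)
    also have "\<dots> \<le> 2 * (real d * (1 / real q))"
      using bls(2) by (intro mult_left_mono mult_right_mono) auto
    also have "\<dots> = 1 / (4 * real (n + 1))"
    proof -
      have "real q = 2 * real d * (4 * real (n + 1))" by (simp add: q_def algebra_simps)
      then show ?thesis using d by (simp only: divide_simps) simp
    qed
    finally show ?thesis .
  qed
  obtain LL where LL: "length LL = n + 1" "\<forall>L \<in> set LL. set L \<subseteq> bfuns m \<and> length L = n + 1"
      "\<forall>x \<in> X. \<not> h (y x) \<longrightarrow> (\<forall>L \<in> set LL. \<exists>S \<in> set L. \<not> W x S)"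
      "\<forall>x \<in> X. h (y x) \<longrightarrow> (\<exists>L \<in> set LL. \<forall>S \<in> set L. \<not> W x S)"
    using amplify[OF X finite_bfuns bfuns_nonempty, where W = W and v = "\<lambda>x. h (y x)", OF small] by blast
  let ?g = "apx Or (map (\<lambda>L. apx And (conj_args bls H L)) LL)"
  let ?ts = "ts0 @ top_gates bls H LL"
  have tree: "tree bls S \<in> vals (D + 2 * d + 1)" for S
    using tree_in_vals[of bls D S] hs bls
      model_vals_mono[of "Suc D + 2 * length bls" "D + 2 * d + 1" n apx] by auto
  \<comment> \<open>\<open>n \<ge> 1\<close> yields at least two rows, as the arity of the top
    disjunction requires.\<close>
  have ok: "admissible (D + 2 * d + 1 + 3) (top_gates bls H LL)" "?g \<in> vals (D + 2 * d + 1 + 4)"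
    using LL n by (intro top_gates_ok tree; force)+
  have right: "(x \<in> tree bls S) \<noteq> (x \<in> tree bls (sym_diff S H)) \<longleftrightarrow> h (y x)" if "\<not> W x S" for x S
  proof -
    have "x \<in> tree bls S \<longleftrightarrow> y x \<in> S" "x \<in> tree bls (sym_diff S H) \<longleftrightarrow> y x \<in> sym_diff S H"
      using that by (auto simp: W_def wrong_def y_def bls(1))
    moreover have "y x \<in> H \<longleftrightarrow> h (y x)"
      by (simp add: H_def cube_def y_def m_def)
    ultimately show ?thesis by auto
  qed
  show ?thesis
  proof (intro exI conjI ballI)
    show "?g \<in> vals (D + (2 * d + 6))"
      using ok(2) model_vals_mono[of "D + 2 * d + 1 + 4" "D + (2 * d + 6)" n apx] by auto
    show "admissible (D + (2 * d + 5)) ?ts"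
      using admissible_mono[OF ok(1), of "D + (2 * d + 5)"]
        admissible_mono[OF ts0(1), of "D + (2 * d + 5)"] bls(2) by simp
    have "length ts0 \<le> d * (q * (n + 1) * (2 ^ b + 1))"
      using ts0(2) bls(2) by (meson le_trans mult_le_mono1)
    moreover have "length (top_gates bls H LL) \<le> (n + 1) * (2 * (n + 1) + 1) + 1"
      using length_top_gates[of LL "n + 1" bls H] LL by simp
    ultimately show "length ?ts \<le> oracle_cost n d (length hs)"
      by (simp only: oracle_cost_def length_append flip: m_def b_def q_def)
  next
    fix x assume x: "x \<in> cube n - errors ?ts"
    then have "x \<in> X" by (simp add: X_def)
    then have "(\<exists>L \<in> set LL. \<forall>S \<in> set L. (x \<in> tree bls S) \<noteq> (x \<in> tree bls (sym_diff S H))) \<longleftrightarrow> h (y x)"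
      using LL(3,4) right by meson
    then show "x \<in> ?g \<longleftrightarrow> h (map (\<lambda>f. x \<in> f) hs)"
      using top_value[of x bls H LL] x by (simp add: y_def)
  qed
qed

section \<open>Simulation of an entire oracle circuit\<close>

text \<open>Induction over the gate list. Each level of the circuit becomes \<open>2 * d + 6\<close>
  levels of the model; a connective costs one tuple, an oracle gate at most
  \<open>oracle_cost n d m\<close>. Values are claimed only up to depth \<open>d\<close>, because
  the depth of a circuit bounds only the gates reachable from its output.\<close>

lemma simulate_gates:
  assumes "wf_gates (oracle_arity m) n gs" and m: "1 \<le> m" and d: "1 \<le> d" and n: "1 \<le> n"
  shows "\<exists>vs ts. length vs = length gs \<and> admissible (d * (2 * d + 6) - 1) ts \<and>
     length ts \<le> length (filter (\<lambda>g. \<not> is_Oracle (fst g)) gs) +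
       length (filter (\<lambda>g. is_Oracle (fst g)) gs) * oracle_cost n d m \<and>
     (\<forall>i < length gs. gate_depths gs ! i \<le> d \<longrightarrow>
        vs ! i \<in> vals (gate_depths gs ! i * (2 * d + 6)) \<and>
        (\<forall>x \<in> cube n - errors ts. x \<in> vs ! i \<longleftrightarrow>
           gate_vals (\<lambda>b. b) (\<lambda>j. x ! j) label_eval gs ! i))"
    (is "\<exists>vs ts. ?sim gs vs ts")
  using assms(1)
proof (induction gs rule: rev_induct)
  case Nil
  then show ?case by (intro exI[of _ "[]"]) simp
next
  case (snoc g gs)
  obtain l ws where g: "g = (l, ws)" by (cases g)
  have wf: "wf_gates (oracle_arity m) n gs" "oracle_arity m l (length ws)"
      "\<forall>w \<in> set ws. wf_wire n (length gs) w"
    using snoc.prems by (auto simp: g wf_gates_snoc)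
  obtain vs ts where sim: "?sim gs vs ts" using snoc.IH[OF wf(1)] by blast
  let ?\<delta> = "wire_depth (gate_depths gs)"
  let ?wv = "wire_val (bconst n) (bvar n) vs"
  let ?bv = "\<lambda>x. gate_vals (\<lambda>b. b) (\<lambda>j. x ! j) label_eval gs"
  let ?fs = "map ?wv ws"
  define e where "e = Max (?\<delta> ` set ws)"
  have depth: "gate_depths (gs @ [g]) = gate_depths gs @ [Suc e]"
    by (simp add: g gate_vals_snoc e_def)
  have val: "gate_vals (\<lambda>b. b) (\<lambda>j. x ! j) label_eval (gs @ [g]) = ?bv x @
      [label_eval l (map (wire_val (\<lambda>b. b) (\<lambda>j. x ! j) (?bv x)) ws)]" for x
    by (simp add: g gate_vals_snoc)
  \<comment> \<open>Old gates keep their guarantees when tuples are added, so the cases below only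
    supply the new value \<open>v\<close> and its tuples \<open>us\<close>.\<close>
  have ext: "?sim (gs @ [g]) (vs @ [v]) (us @ ts)"
    if "admissible (d * (2 * d + 6) - 1) us"
      and "length us \<le> (if is_Oracle l then oracle_cost n d m else 1)"
      and "Suc e \<le> d \<Longrightarrow> v \<in> vals (Suc e * (2 * d + 6)) \<and>
        (\<forall>x \<in> cube n - errors (us @ ts). x \<in> v \<longleftrightarrow>
           label_eval l (map (wire_val (\<lambda>b. b) (\<lambda>j. x ! j) (?bv x)) ws))" for v us
  proof (intro conjI allI impI)
    show "length (vs @ [v]) = length (gs @ [g])" "admissible (d * (2 * d + 6) - 1) (us @ ts)"
      using sim that(1) by simp_all
    show "length (us @ ts) \<le> length (filter (\<lambda>g. \<not> is_Oracle (fst g)) (gs @ [g])) +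
       length (filter (\<lambda>g. is_Oracle (fst g)) (gs @ [g])) * oracle_cost n d m"
      using sim that(2) by (cases "is_Oracle l") (simp_all add: g)
    fix i assume i: "i < length (gs @ [g])" "gate_depths (gs @ [g]) ! i \<le> d"
    have "(vs @ [v]) ! i \<in> vals (gate_depths (gs @ [g]) ! i * (2 * d + 6)) \<and>
        (\<forall>x \<in> cube n - errors (us @ ts). x \<in> (vs @ [v]) ! i \<longleftrightarrow>
           gate_vals (\<lambda>b. b) (\<lambda>j. x ! j) label_eval (gs @ [g]) ! i)"
    proof (cases "i < length gs")
      case True
      then show ?thesis using sim i unfolding depth val by (simp add: nth_append)
    next
      case False
      then have "i = length gs" using i(1) by simp
      then show ?thesis using sim i(2) that(3) unfolding depth val by (simp add: nth_append)
    qed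
    then show "(vs @ [v]) ! i \<in> vals (gate_depths (gs @ [g]) ! i * (2 * d + 6))"
      and "\<forall>x \<in> cube n - errors (us @ ts). x \<in> (vs @ [v]) ! i \<longleftrightarrow>
           gate_vals (\<lambda>b. b) (\<lambda>j. x ! j) label_eval (gs @ [g]) ! i"
      by blast+
  qed
  show ?case
  proof (cases "Suc e \<le> d")
    case False
    \<comment> \<open>A gate deeper than \<open>d\<close> gets the placeholder \<open>{}\<close>,
      about which nothing is claimed.\<close>
    have "?sim (gs @ [g]) (vs @ [{}]) ([] @ ts)"
      by (rule ext) (use False in simp_all)
    then show ?thesis by (intro exI)
  next
    case True
    have le_e: "?\<delta> w \<le> e" if "w \<in> set ws" for w
      using that by (auto simp: e_def)
    have wire: "?wv w \<in> vals (e * (2 * d + 6)) \<and>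
        (\<forall>x \<in> cube n - errors ts. x \<in> ?wv w \<longleftrightarrow> wire_val (\<lambda>b. b) (\<lambda>j. x ! j) (?bv x) w)"
      if w: "w \<in> set ws" for w
    proof (cases w)
      case (Const c)
      then show ?thesis using bconst_in_model_vals by (auto simp: bconst_def)
    next
      case (Input j)
      then show ?thesis using wf(3) w bvar_in_model_vals by (auto simp: bvar_def)
    next
      case (Node j)
      then have "j < length gs" using wf(3) w by auto
      moreover have "gate_depths gs ! j \<le> e" using le_e[OF w] Node by simp
      moreover from this have "vals (gate_depths gs ! j * (2 * d + 6)) \<subseteq> vals (e * (2 * d + 6))"
        by (intro model_vals_mono mult_le_mono1)
      ultimately show ?thesis using sim Node True by auto
    qed
    then have fs: "set ?fs \<subseteq> vals (e * (2 * d + 6))" by auto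
    have args: "map (\<lambda>f. x \<in> f) ?fs = map (wire_val (\<lambda>b. b) (\<lambda>j. x ! j) (?bv x)) ws"
      if "x \<in> cube n - errors ts" for x
      using wire that by simp
    have "Suc e * (2 * d + 6) \<le> d * (2 * d + 6)" using True by (rule mult_le_mono1)
    \<comment> \<open>Arguments of error tuples lie one level below the final depth, as
      \<open>depth_distance\<close> demands.\<close>
    then have bound: "e * (2 * d + 6) + (2 * d + 5) \<le> d * (2 * d + 6) - 1" by simp
    show ?thesis
    proof (cases l)
      case (Conn c)
      have ar: "conn_arity c (length ?fs)" using wf(2) Conn by simp
      have "admissible (e * (2 * d + 6)) [(c, ?fs)]"
        using fs ar by simp
      then have "admissible (d * (2 * d + 6) - 1) [(c, ?fs)]"
        by (rule admissible_mono) (use bound in linarith)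
      moreover have "apx c ?fs \<in> vals (Suc e * (2 * d + 6))"
        using model_vals_apply[of ?fs n apx _ c, OF fs ar]
          model_vals_mono[of "Suc (e * (2 * d + 6))" "Suc e * (2 * d + 6)" n apx] by auto
      moreover have "x \<in> apx c ?fs \<longleftrightarrow>
          label_eval l (map (wire_val (\<lambda>b. b) (\<lambda>j. x ! j) (?bv x)) ws)"
        if "x \<in> cube n - errors ([(c, ?fs)] @ ts)" for x
      proof -
        have x: "x \<in> cube n" "x \<in> cube n - errors ts" "x \<notin> error_set n apx c ?fs"
          using that by simp_all
        show ?thesis
          unfolding Conn label_eval.simps args[OF x(2), symmetric] by (rule apx_sound[OF x(1,3)])
      qed
      ultimately have "?sim (gs @ [g]) (vs @ [apx c ?fs]) ([(c, ?fs)] @ ts)"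
        using Conn by (intro ext) auto
      then show ?thesis by (intro exI)
    next
      case (Oracle h)
      have len: "length ?fs = m" using wf(2) Oracle by simp
      obtain v us where v: "v \<in> vals (e * (2 * d + 6) + (2 * d + 6))"
          "admissible (e * (2 * d + 6) + (2 * d + 5)) us" "length us \<le> oracle_cost n d (length ?fs)"
          "\<forall>x \<in> cube n - errors us. x \<in> v \<longleftrightarrow> h (map (\<lambda>f. x \<in> f) ?fs)"
        using oracle_gate[OF fs _ d n, of h] m len by auto
      have "admissible (d * (2 * d + 6) - 1) us"
        using v(2) bound by (rule admissible_mono)
      moreover have "v \<in> vals (Suc e * (2 * d + 6))"
        using v(1) by (simp add: add.commute)
      moreover have "x \<in> v \<longleftrightarrow> label_eval l (map (wire_val (\<lambda>b. b) (\<lambda>j. x ! j) (?bv x)) ws)"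
        if "x \<in> cube n - errors (us @ ts)" for x
      proof -
        have x: "x \<in> cube n - errors us" "x \<in> cube n - errors ts"
          using that by simp_all
        show ?thesis
          unfolding Oracle label_eval.simps args[OF x(2), symmetric] by (rule bspec[OF v(4) x(1)])
      qed
      ultimately have "?sim (gs @ [g]) (vs @ [v]) (us @ ts)"
        using Oracle v(3) len by (intro ext) auto
      then show ?thesis by (intro exI)
    qed
  qed
qed

text \<open>The \<open>circuit_size C - k\<close> connective gates contribute one tuple each, the
  \<open>k\<close> oracle gates the rest; the value of the output wire is the required
  \<open>g\<close>.\<close>

lemma simulate_circuit:
  assumes C: "oracle_circuit n k m C" "circuit_depth C \<le> d" "computes n C f"
    and m: "1 \<le> m" and d: "1 \<le> d" and n: "1 \<le> n"
  shows "depth_distance n M apx (d * (2 * d + 6)) f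
     \<le> enat (circuit_size C - k + k * oracle_cost n d m)"
proof -
  obtain gs w where Cg: "C = (gs, w)" by (cases C)
  have wf: "wf_gates (oracle_arity m) n gs" "wf_wire n (length gs) w"
      and k: "length (filter (\<lambda>g. is_Oracle (fst g)) gs) = k"
    using C(1) by (auto simp: Cg oracle_circuit_def wf_circuit_iff)
  obtain vs ts where vs: "length vs = length gs"
      and adm: "admissible (d * (2 * d + 6) - 1) ts"
      and len: "length ts \<le> length (filter (\<lambda>g. \<not> is_Oracle (fst g)) gs) + k * oracle_cost n d m"
      and sim: "\<forall>i < length gs. gate_depths gs ! i \<le> d \<longrightarrow>
        vs ! i \<in> vals (gate_depths gs ! i * (2 * d + 6)) \<and>
        (\<forall>x \<in> cube n - errors ts. x \<in> vs ! i \<longleftrightarrow>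
           gate_vals (\<lambda>b. b) (\<lambda>j. x ! j) label_eval gs ! i)"
    using simulate_gates[OF wf(1) m d n] unfolding k by blast
  let ?g = "wire_val (bconst n) (bvar n) vs w"
  let ?D = "d * (2 * d + 6)"
  have dw: "wire_depth (gate_depths gs) w \<le> d" using C(2) by (simp add: Cg circuit_depth_eq)
  have g: "?g \<in> vals ?D \<and> (\<forall>x \<in> cube n - errors ts. x \<in> ?g \<longleftrightarrow>
      wire_val (\<lambda>b. b) (\<lambda>j. x ! j) (gate_vals (\<lambda>b. b) (\<lambda>j. x ! j) label_eval gs) w)"
  proof (cases w)
    case (Const c)
    then show ?thesis using bconst_in_model_vals by (auto simp: bconst_def)
  next
    case (Input j)
    then show ?thesis using wf(2) bvar_in_model_vals by (auto simp: bvar_def)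
  next
    case (Node j)
    then have "j < length gs" "gate_depths gs ! j \<le> d" using wf(2) dw by auto
    moreover from this have "vals (gate_depths gs ! j * (2 * d + 6)) \<subseteq> vals ?D"
      by (intro model_vals_mono mult_le_mono1)
    ultimately show ?thesis using sim Node by auto
  qed
  have M: "?g \<in> M" using g model_vals_subset_model[OF legitimate] by blast
  \<comment> \<open>Agreement is known only on the cube, so the approximator must not contain points
    outside it.\<close>
  then have "?g \<subseteq> cube n" using legitimate by (auto simp: legitimate_model_def bfuns_def)
  then have "sym_diff f ?g \<subseteq> errors ts"
    using g C(3) by (auto simp: computes_def circuit_val_def Cg)
  then have "depth_distance n M apx ?D f \<le> enat (length ts)"
    using depth_distance_le[OF M, of n apx ?D ts f] g adm
    by (simp add: errors_def admissible_def)
  also have "length (filter (\<lambda>g. \<not> is_Oracle (fst g)) gs) = circuit_size C - k"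
    using sum_length_filter_compl[of "\<lambda>g. is_Oracle (fst g)" gs] k by (simp add: circuit_size_def Cg)
  then have "enat (length ts) \<le> enat (circuit_size C - k + k * oracle_cost n d m)"
    using len by simp
  finally show ?thesis .
qed

end

section \<open>The case without variables and the numerical bound\<close>

text \<open>For \<open>n = 0\<close> every function is a constant and lies in the model at depth 0.
  This contradicts \<open>s \<ge> 1\<close> and settles the case excluded in
  \<open>oracle_gate\<close>.\<close>

lemma depth_distance_zero_vars:
  assumes "legitimate_model 0 M apx" "f \<in> bfuns 0"
  shows "depth_distance 0 M apx D f = 0"
proof -
  have "cube 0 = {[]}" by (auto simp: cube_def)
  then have "f = bconst 0 False \<or> f = bconst 0 True"
    using assms(2) by (simp add: bfuns_def bconst_def subset_singleton_iff)
  then obtain b where f: "f = bconst 0 b" by blast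
  have "f \<in> M" using assms(1) by (auto simp: legitimate_model_def f)
  then show ?thesis
    using depth_distance_le[of f M 0 apx D "[]" f] bconst_in_model_vals[of 0 b apx D]
    by (simp add: f flip: zero_enat_def)
qed

text \<open>\<open>75 = 64 + 11\<close>. In the first summand 8 is multiplied by 2 three times, from
  \<open>n + 1 \<le> 2 * n\<close> twice and from rounding \<open>m / d\<close> up; the rest is at
  most \<open>10 * n\<^sup>2 + n\<^sup>2\<close>.\<close>

lemma oracle_cost_le:
  assumes "1 \<le> d" "1 \<le> n"
  shows "real (oracle_cost n d m) \<le> 75 * (real d * real n * (2 powr (real m / real d) + 1))\<^sup>2"
proof -
  define b where "b = (m + d - 1) div d"
  define P where "P = (2::real) powr (real m / real d) + 1"
  have P: "1 \<le> P" by (simp add: P_def)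
  have "d * b \<le> m + d - 1" by (simp add: b_def)
  then have "d * b \<le> m + d" by linarith
  then have "real d * real b \<le> real m + real d" by (metis of_nat_add of_nat_le_iff of_nat_mult)
  then have "real b \<le> real m / real d + 1"
    using assms by (simp add: field_simps)
  then have "2 powr real b \<le> 2 powr (real m / real d + 1)" by simp
  then have b: "2 ^ b + 1 \<le> 2 * P"
    by (simp add: P_def powr_add powr_realpow)
  have n: "real n + 1 \<le> 2 * real n" "1 \<le> real n" and d: "1 \<le> real d" using assms by simp_all
  define Q where "Q = real d * real n * P"
  have dn: "1 \<le> real d * real n" using n d mult_mono[of 1 "real d" 1 "real n"] by simp
  have nQ: "real n \<le> Q"
    using n d P mult_mono[of 1 "real d * P" "real n" "real n"] mult_mono[of 1 "real d" 1 P]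
    by (simp add: Q_def ac_simps)
  then have Q: "1 \<le> Q" using n by linarith
  have "P \<le> P\<^sup>2" using P by (simp add: power2_eq_square)
  then have "(real d * real n)\<^sup>2 * P \<le> (real d * real n)\<^sup>2 * P\<^sup>2"
    by (rule mult_left_mono) simp
  then have dnP: "(real d * real n)\<^sup>2 * P \<le> Q\<^sup>2"
    by (simp add: Q_def power_mult_distrib)
  have "real d * (8 * real d * (real n + 1) * (real n + 1) * (2 ^ b + 1))
      \<le> real d * (8 * real d * (2 * real n) * (2 * real n) * (2 * P))"
    using n d b by (intro mult_left_mono mult_mono) auto
  also have "\<dots> = 64 * ((real d * real n)\<^sup>2 * P)" by (simp add: power2_eq_square)
  also have "\<dots> \<le> 64 * Q\<^sup>2" using dnP by simp
  finally have 1: "real d * (8 * real d * (real n + 1) * (real n + 1) * (2 ^ b + 1)) \<le> 64 * Q\<^sup>2" .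
  have "(real n + 1) * (2 * (real n + 1) + 1) + 1 \<le> (2 * real n) * (5 * real n) + real n * real n"
  proof (rule add_mono)
    show "(real n + 1) * (2 * (real n + 1) + 1) \<le> (2 * real n) * (5 * real n)"
      using n by (intro mult_mono) auto
    show "1 \<le> real n * real n" using n mult_mono[of 1 "real n" 1 "real n"] by simp
  qed
  also have "\<dots> = 11 * (real n)\<^sup>2" by (simp add: power2_eq_square)
  also have "\<dots> \<le> 11 * Q\<^sup>2" using nQ n by (intro mult_left_mono power_mono) auto
  finally have 2: "(real n + 1) * (2 * (real n + 1) + 1) + 1 \<le> 11 * Q\<^sup>2" .
  have "real (oracle_cost n d m) = real d * (8 * real d * (real n + 1) * (real n + 1) * (2 ^ b + 1))
      + ((real n + 1) * (2 * (real n + 1) + 1) + 1)"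
    by (simp add: oracle_cost_def b_def algebra_simps)
  also have "\<dots> \<le> 75 * Q\<^sup>2" using 1 2 by linarith
  finally show ?thesis by (simp add: Q_def P_def)
qed

theorem theorem5:
  "\<exists>K::nat. \<forall>(n::nat) (M::bool list set set)
       (apx::connective \<Rightarrow> bool list set list \<Rightarrow> bool list set)
       (f::bool list set) (d::nat) (s::nat) (k::nat) (m::nat).
     legitimate_model n M apx \<longrightarrow>
     (\<forall>h \<in> M. apx Neg [h] = cube n - h) \<longrightarrow>
     f \<in> bfuns n \<longrightarrow>
     1 \<le> d \<longrightarrow> 1 \<le> s \<longrightarrow> 1 \<le> k \<longrightarrow> 1 \<le> m \<longrightarrow>
     enat s \<le> depth_distance n M apx (d * (2 * d + 6)) f \<longrightarrow>
     \<not> (\<exists>C. oracle_circuit n k m C \<and> circuit_depth C \<le> d \<and> computes n C f \<and>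
          real (circuit_size C) \<le>
            real s - real K * (real k * real d * real n * (2 powr (real m / real d) + 1)) ^ K)"
proof (rule exI[of _ 75], intro allI impI notI)
  fix n M apx f d s k m
  assume legit: "legitimate_model n M apx" and neg: "\<forall>h \<in> M. apx Neg [h] = cube n - h"
    and f: "f \<in> bfuns n" and pos: "1 \<le> d" "1 \<le> s" "1 \<le> k" "1 \<le> m"
    and dist: "enat s \<le> depth_distance n M apx (d * (2 * d + 6)) f"
    and "\<exists>C. oracle_circuit n k m C \<and> circuit_depth C \<le> d \<and> computes n C f \<and>
          real (circuit_size C) \<le>
            real s - real 75 * (real k * real d * real n * (2 powr (real m / real d) + 1)) ^ 75"
  then obtain C where C: "oracle_circuit n k m C" "circuit_depth C \<le> d" "computes n C f"
      and size: "real (circuit_size C) \<le>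
        real s - real 75 * (real k * real d * real n * (2 powr (real m / real d) + 1)) ^ 75"
    by blast
  interpret negation_model n M apx
    using legit neg by unfold_locales auto
  have n: "1 \<le> n"
  proof (rule ccontr)
    assume "\<not> 1 \<le> n"
    then have "n = 0" by simp
    then have "enat s \<le> 0"
      using depth_distance_zero_vars[of M apx f] legit f dist by simp
    then show False using pos(2) by (simp add: zero_enat_def)
  qed
  define R where "R = real d * real n * (2 powr (real m / real d) + 1)"
  define Q where "Q = real k * R"
  have "1 \<le> real d * real n" using pos n mult_mono[of 1 "real d" 1 "real n"] by simp
  then have R: "1 \<le> R"
    using mult_mono[of 1 "real d * real n" 1 "2 powr (real m / real d) + 1"] by (simp add: R_def)
  have k: "1 \<le> real k" using pos by simp
  have Q: "1 \<le> Q" using R k mult_mono[of 1 "real k" 1 R] by (simp add: Q_def)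
  have "real k \<le> (real k)\<^sup>2" using k by (simp add: power2_eq_square)
  have "real k * real (oracle_cost n d m) \<le> real k * (75 * R\<^sup>2)"
    using oracle_cost_le[OF pos(1) n] by (intro mult_left_mono) (auto simp: R_def)
  also have "\<dots> \<le> (real k)\<^sup>2 * (75 * R\<^sup>2)"
    using \<open>real k \<le> (real k)\<^sup>2\<close> by (intro mult_right_mono) auto
  also have "\<dots> = 75 * Q ^ 2" by (simp add: Q_def power_mult_distrib)
  \<comment> \<open>The constant \<open>K = 75\<close> is also the exponent; as
    \<open>Q \<ge> 1\<close>, passing from the square to this power only increases the
    bound.\<close>
  also have "\<dots> \<le> 75 * Q ^ 75" using Q by (intro mult_left_mono power_increasing) auto
  finally have cost: "real k * real (oracle_cost n d m) \<le> 75 * Q ^ 75" .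
  \<comment> \<open>Makes the truncated subtraction \<open>circuit_size C - k\<close> exact over the
    reals.\<close>
  have "k \<le> circuit_size C"
    using C(1) length_filter_le[of "\<lambda>g. is_Oracle (fst g)" "fst C"]
    by (simp add: oracle_circuit_def circuit_size_def)
  moreover have "s \<le> circuit_size C - k + k * oracle_cost n d m"
    using order_trans[OF dist simulate_circuit[OF C pos(4,1) n]] by simp
  ultimately have "real s \<le> real (circuit_size C) - real k + real k * real (oracle_cost n d m)"
    by (metis of_nat_add of_nat_diff of_nat_le_iff of_nat_mult)
  \<comment> \<open>Inserting the assumed size bound leaves \<open>s \<le> s - k\<close>, impossible
    for \<open>k \<ge> 1\<close>.\<close>
  then show False
    using size cost k by (simp add: Q_def R_def mult.assoc)
qed

end
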